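(* Let $u$ be any mild solution of the Patlak-Keller-Segel system which exists on some time interval $[0,T]$ with $T<\infty$. Then $\sup_{t\in(0,T)} t^{1-1/p}\|u(t)\|_{L^p} < \infty$ for all $p\in[1,\infty]$.
   Context: The PKS system in $\mathbb{R}^2$ is $u_t + \nabla\cdot(u\nabla c) = \Delta u$, $-\Delta c = u$. Given $\mu \in \mathcal{M}_+(\mathbb{R}^2)$ (finite non-negative Borel measures), $u$ is a mild solution with initial data $\mu$ on $[0,T)$ if: $u(t)\rightharpoonup^\star\mu$ as $t\searrow 0$; $u\in C_w([0,T];\mathcal{M}_+(\mathbb{R}^2))$ (weak$^\star$ continuous in time) and $\sup_{t\in(0,T)}t^{1/4}\|u(t)\|_{L^{4/3}}<\infty$; and for all $t\in(0,T)$, $u(t) = e^{t\Delta}\mu - \int_0^t e^{(t-s)\Delta}\nabla\cdot(u(s)\nabla c(s))ds$ with $c(t,x) = -\frac{1}{2\pi}\int\log|x-y|u(t,y)dy$. *)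

theory Defs
  imports "HOL-Probability.Probability"
begin

type_synonym R2 = "real^2"

definition M_plus :: "R2 measure \<Rightarrow> bool" where
  "M_plus \<mu> \<longleftrightarrow> sets \<mu> = sets (borel :: R2 measure) \<and> finite_measure \<mu>"

text \<open>Test functions for the weak-star topology of M(R^2) = C_0(R^2)'.\<close>
definition C0 :: "(R2 \<Rightarrow> real) set" where
  "C0 = {\<phi>. continuous_on UNIV \<phi> \<and> (\<phi> \<longlongrightarrow> 0) at_infinity}"

definition heat_kernel :: "real \<Rightarrow> R2 \<Rightarrow> real" where
  "heat_kernel t z = exp (- (norm z)\<^sup>2 / (4 * t)) / (4 * pi * t)"

definition grad_heat_kernel :: "real \<Rightarrow> R2 \<Rightarrow> R2" where
  "grad_heat_kernel t z = (- heat_kernel t z / (2 * t)) *\<^sub>R z"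

definition heat_measure :: "real \<Rightarrow> R2 measure \<Rightarrow> R2 \<Rightarrow> real" where
  "heat_measure t \<mu> x = (\<integral>y. heat_kernel t (x - y) \<partial>\<mu>)"

text \<open>Gradient of c = -(1/2pi) log|.| * v, i.e. the Biot--Savart type kernel.\<close>
definition grad_c :: "(R2 \<Rightarrow> real) \<Rightarrow> R2 \<Rightarrow> R2" where
  "grad_c v y = (- 1 / (2 * pi)) *\<^sub>R (\<integral>z. (v z / (norm (y - z))\<^sup>2) *\<^sub>R (y - z) \<partial>lborel)"

definition in_Lp :: "real \<Rightarrow> (R2 \<Rightarrow> real) \<Rightarrow> bool" where
  "in_Lp p f \<longleftrightarrow> f \<in> borel_measurable lborel \<and> integrable lborel (\<lambda>x. \<bar>f x\<bar> powr p)"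

definition Lp_norm :: "real \<Rightarrow> (R2 \<Rightarrow> real) \<Rightarrow> real" where
  "Lp_norm p f = (\<integral>x. \<bar>f x\<bar> powr p \<partial>lborel) powr (1 / p)"

definition in_Linf :: "(R2 \<Rightarrow> real) \<Rightarrow> bool" where
  "in_Linf f \<longleftrightarrow> f \<in> borel_measurable lborel \<and> esssup lborel (\<lambda>x. ereal \<bar>f x\<bar>) < \<infinity>"

definition Linf_norm :: "(R2 \<Rightarrow> real) \<Rightarrow> real" where
  "Linf_norm f = real_of_ereal (esssup lborel (\<lambda>x. ereal \<bar>f x\<bar>))"

definition duhamel_integrand :: "(real \<Rightarrow> R2 \<Rightarrow> real) \<Rightarrow> real \<Rightarrow> R2 \<Rightarrow> real \<times> R2 \<Rightarrow> real" where
  "duhamel_integrand u t x = (\<lambda>(s, y). indicator {0<..<t} s *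
      (grad_heat_kernel (t - s) (x - y) \<bullet> (u s y *\<^sub>R grad_c (u s) y)))"

text \<open>Mild solution of PKS on [0,T) with initial datum mu. For t in (0,T), u t is the
  density of the measure u(t); the family nu is u viewed in C_w([0,T]; M_+).\<close>
definition mild_solution :: "real \<Rightarrow> R2 measure \<Rightarrow> (real \<Rightarrow> R2 \<Rightarrow> real) \<Rightarrow> bool" where
  "mild_solution T \<mu> u \<longleftrightarrow>
     M_plus \<mu> \<and>
     (\<forall>t\<in>{0<..<T}. u t \<in> borel_measurable lborel \<and> (AE x in lborel. 0 \<le> u t x)
                     \<and> integrable lborel (u t)) \<and>
     (\<forall>\<phi>\<in>C0. ((\<lambda>t. \<integral>x. \<phi> x * u t x \<partial>lborel) \<longlongrightarrow> (\<integral>x. \<phi> x \<partial>\<mu>)) (at_right 0)) \<and>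
     (\<exists>\<nu> :: real \<Rightarrow> R2 measure.
        \<nu> 0 = \<mu> \<and> (\<forall>t\<in>{0..T}. M_plus (\<nu> t)) \<and>
        (\<forall>t\<in>{0<..<T}. \<nu> t = density lborel (\<lambda>x. ennreal (u t x))) \<and>
        (\<forall>\<phi>\<in>C0. continuous_on {0..T} (\<lambda>t. \<integral>x. \<phi> x \<partial>(\<nu> t)))) \<and>
     (\<exists>K. \<forall>t\<in>{0<..<T}. in_Lp (4/3) (u t) \<and> t powr (1/4) * Lp_norm (4/3) (u t) \<le> K) \<and>
     (\<forall>t\<in>{0<..<T}. AE x in lborel.
        integrable (lborel \<Otimes>\<^sub>M lborel) (duhamel_integrand u t x) \<and>
        u t x = heat_measure t \<mu> x - (\<integral>sy. duhamel_integrand u t x sy \<partial>(lborel \<Otimes>\<^sub>M lborel)))"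

end

theory Submission
  imports Defs
begin

text \<open>
  All bounds are invariant under the parabolic scaling, and the bootstrap runs on the modulus of the
  flux \<open>F = u \<nabla>c\<close>. The only critical estimate is the first one: the diagonal
  Hardy--Littlewood--Sobolev inequality turns the \<open>L\<^bsup>4/3\<^esup>\<close> hypothesis into
  \<open>\<parallel>F(s)\<parallel>\<^sub>1 \<lesssim> s\<^bsup>-1/2\<^esup>\<close>. From then on every step has room
  to spare: Duhamel's formula, Young's inequality in space and Minkowski's in time convert a
  scale-invariant \<open>L\<^sup>r\<close> bound on \<open>F\<close> into one on \<open>u\<close> in
  \<open>L\<^sup>q\<close> whenever \<open>1/q > 1/r - 1/2\<close>. With \<open>r = 1\<close> this gives
  \<open>u\<close> in \<open>L\<^sup>1\<close> and \<open>L\<^bsup>7/4\<^esup>\<close>, hence \<open>F\<close> in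
  \<open>L\<^bsup>7/6\<^esup>\<close>, hence \<open>u\<close> in \<open>L\<^bsup>5/2\<^esup>\<close>. Since
  \<open>5/2 > 2\<close>, the drift \<open>\<nabla>c\<close> is then bounded by a multiple of
  \<open>s\<^bsup>-1/2\<^esup>\<close>, and a last application of Duhamel's formula, using the
  \<open>L\<^sup>1\<close> bound on \<open>F\<close> for \<open>s < t/2\<close> and the \<open>L\<^bsup>5/2\<^esup>\<close>
  bound for \<open>s > t/2\<close>, bounds \<open>u\<close> uniformly. The remaining exponents follow by
  interpolation with \<open>L\<^sup>1\<close>.
\<close>

section \<open>Convolution inequalities\<close>

lemma nn_integral_lborel_diff:
  fixes f :: "'a::euclidean_space \<Rightarrow> ennreal"
  assumes [measurable]: "f \<in> borel_measurable borel"
  shows "(\<integral>\<^sup>+y. f (x - y) \<partial>lborel) = (\<integral>\<^sup>+y. f y \<partial>lborel)"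
proof -
  have "(\<integral>\<^sup>+y. f y \<partial>lborel) = (\<integral>\<^sup>+y. f y \<partial>(density (distr lborel borel (\<lambda>y. x + (- 1::real) *\<^sub>R y)) (\<lambda>_. \<bar>- 1::real\<bar> ^ DIM('a))))"
    by (subst lborel_affine[of "-1" x]) simp_all
  also have "\<dots> = (\<integral>\<^sup>+y. f (x - y) \<partial>lborel)"
    by (subst nn_integral_density) (auto simp: nn_integral_distr)
  finally show ?thesis by simp
qed

lemma nn_integral_lborel_diff':
  fixes f :: "'a::euclidean_space \<Rightarrow> ennreal"
  assumes [measurable]: "f \<in> borel_measurable borel"
  shows "(\<integral>\<^sup>+x. f (x - y) \<partial>lborel) = (\<integral>\<^sup>+x. f x \<partial>lborel)"
proof -
  have "(\<integral>\<^sup>+x. f x \<partial>lborel) = (\<integral>\<^sup>+x. f x \<partial>(distr lborel borel ((+) (- y))))"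
    by (simp add: lborel_distr_plus)
  also have "\<dots> = (\<integral>\<^sup>+x. f (x - y) \<partial>lborel)"
    by (simp add: nn_integral_distr)
  finally show ?thesis by simp
qed

lemma nn_integral_Holder:
  fixes F H :: "'a \<Rightarrow> real"
  assumes pq: "p > 1" "q > 1" "1/p + 1/q = 1"
    and [measurable]: "F \<in> borel_measurable M" "H \<in> borel_measurable M"
    and pos: "\<And>x. 0 \<le> F x" "\<And>x. 0 \<le> H x" "0 \<le> a" "0 \<le> b"
    and Fa: "(\<integral>\<^sup>+x. ennreal (F x powr p) \<partial>M) \<le> ennreal a"
    and Hb: "(\<integral>\<^sup>+x. ennreal (H x powr q) \<partial>M) \<le> ennreal b"
  shows "(\<integral>\<^sup>+x. ennreal (F x * H x) \<partial>M) \<le> ennreal (a powr (1/p) * b powr (1/q))"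
proof (cases "a = 0 \<or> b = 0")
  case True
  then have "AE x in M. F x * H x = 0"
  proof
    assume "a = 0"
    then have "(\<integral>\<^sup>+x. ennreal (F x powr p) \<partial>M) = 0" using Fa by simp
    then have "AE x in M. ennreal (F x powr p) = 0"
      by (subst (asm) nn_integral_0_iff_AE) simp_all
    then show ?thesis by eventually_elim (use pos in auto)
  next
    assume "b = 0"
    then have "(\<integral>\<^sup>+x. ennreal (H x powr q) \<partial>M) = 0" using Hb by simp
    then have "AE x in M. ennreal (H x powr q) = 0"
      by (subst (asm) nn_integral_0_iff_AE) simp_all
    then show ?thesis by eventually_elim (use pos in auto)
  qed
  then have "(\<integral>\<^sup>+x. ennreal (F x * H x) \<partial>M) = (\<integral>\<^sup>+x. 0 \<partial>M)"
    by (intro nn_integral_cong_AE) (auto elim: eventually_mono)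
  then show ?thesis by simp
next
  case False
  with pos have ab: "a > 0" "b > 0" by auto
  define c where "c = a powr (1/p) * b powr (1/q)"
  have c: "c > 0" using ab by (simp add: c_def)
  have pw: "F x * H x \<le> c / (a * p) * F x powr p + c / (b * q) * H x powr q" for x
  proof -
    have "(F x / a powr (1/p)) * (H x / b powr (1/q)) \<le>
        (F x / a powr (1/p)) powr p / p + (H x / b powr (1/q)) powr q / q"
      using pq pos by (intro Youngs_inequality) auto
    also have "\<dots> = F x powr p / (a * p) + H x powr q / (b * q)"
      using pq ab pos by (simp add: powr_divide powr_powr)
    finally have "c * ((F x / a powr (1/p)) * (H x / b powr (1/q))) \<le> c * (F x powr p / (a * p) + H x powr q / (b * q))"
      using c by (intro mult_left_mono) auto
    moreover have "c * ((F x / a powr (1/p)) * (H x / b powr (1/q))) = F x * H x"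
      using ab by (simp add: c_def)
    ultimately show ?thesis by (simp add: algebra_simps)
  qed
  have nn: "0 \<le> c / (a * p)" "0 \<le> c / (b * q)" using c ab pq by auto
  have "(\<integral>\<^sup>+x. ennreal (F x * H x) \<partial>M) \<le>
      (\<integral>\<^sup>+x. ennreal (c / (a * p)) * ennreal (F x powr p) + ennreal (c / (b * q)) * ennreal (H x powr q) \<partial>M)"
  proof (rule nn_integral_mono)
    fix x
    define k l where "k = c / (a * p)" and "l = c / (b * q)"
    have "F x * H x \<le> k * F x powr p + l * H x powr q" "0 \<le> k" "0 \<le> l"
      using pw nn by (auto simp: k_def l_def)
    then show "ennreal (F x * H x) \<le> ennreal (c / (a * p)) * ennreal (F x powr p) + ennreal (c / (b * q)) * ennreal (H x powr q)"
      unfolding k_def[symmetric] l_def[symmetric] by (simp flip: ennreal_mult' ennreal_plus)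
  qed
  also have "\<dots> = ennreal (c / (a * p)) * (\<integral>\<^sup>+x. ennreal (F x powr p) \<partial>M)
      + ennreal (c / (b * q)) * (\<integral>\<^sup>+x. ennreal (H x powr q) \<partial>M)"
    by (simp add: nn_integral_add nn_integral_cmult)
  also have "\<dots> \<le> ennreal (c / (a * p)) * ennreal a + ennreal (c / (b * q)) * ennreal b"
    by (intro add_mono mult_left_mono Fa Hb) auto
  also have "\<dots> = ennreal (c / (a * p) * a + c / (b * q) * b)"
    using c ab pq(1,2) by (simp flip: ennreal_mult' ennreal_plus)
  also have "c / (a * p) * a + c / (b * q) * b = c * (1/p + 1/q)"
    using ab pq(1,2) by (simp add: field_simps)
  finally show ?thesis using pq by (simp add: c_def)
qed

lemma powr_le_nn_integral_Holder:
  fixes F H :: "'a \<Rightarrow> real"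
  assumes pq: "p > 1" "q > 1" "1/p + 1/q = 1"
    and [measurable]: "F \<in> borel_measurable M" "H \<in> borel_measurable M"
    and pos: "\<And>x. 0 \<le> F x" "\<And>x. 0 \<le> H x" "0 \<le> v" "0 < b"
    and v: "ennreal v \<le> (\<integral>\<^sup>+x. ennreal (F x * H x) \<partial>M)"
    and Hb: "(\<integral>\<^sup>+x. ennreal (H x powr q) \<partial>M) \<le> ennreal b"
  shows "ennreal (v powr p) \<le> ennreal (b powr (p - 1)) * (\<integral>\<^sup>+x. ennreal (F x powr p) \<partial>M)"
proof (cases "(\<integral>\<^sup>+x. ennreal (F x powr p) \<partial>M)")
  case (real a)
  have "ennreal v \<le> ennreal (a powr (1/p) * b powr (1/q))"
    using real pos Hb by (intro order.trans[OF v] nn_integral_Holder[OF pq]) auto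
  then have "v \<le> a powr (1/p) * b powr (1/q)"
    by (subst (asm) ennreal_le_iff) auto
  then have "v powr p \<le> (a powr (1/p) * b powr (1/q)) powr p"
    using pos pq by (intro powr_mono2) auto
  also have "\<dots> = a * b powr (p / q)"
    using real pos pq by (simp add: powr_mult powr_powr)
  also have "p / q = p - 1" using pq by (simp add: field_simps)
  finally show ?thesis using real pos by (simp add: mult.commute flip: ennreal_mult')
next
  case top
  then show ?thesis using pos by (simp add: ennreal_mult_top)
qed

lemma powr_mult_powr_le_add:
  fixes x y \<theta> :: real
  assumes "0 \<le> x" "0 \<le> y" "0 \<le> \<theta>" "\<theta> \<le> 1"
  shows "x powr \<theta> * y powr (1 - \<theta>) \<le> x + y"
proof (cases "x = 0 \<or> y = 0")
  case False
  then have "x powr \<theta> * y powr (1 - \<theta>) \<le> \<theta> * x + (1 - \<theta>) * y"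
    using assms by (intro Youngs_inequality_0) auto
  also have "\<dots> \<le> 1 * x + 1 * y"
    using assms by (intro add_mono mult_right_mono) auto
  finally show ?thesis by simp
qed (use assms in auto)

lemma Young_Minkowski:
  fixes G f :: "'s \<Rightarrow> 'a::euclidean_space \<Rightarrow> real" and A B :: "'s \<Rightarrow> real" and v :: "'a \<Rightarrow> real"
  assumes "sigma_finite_measure S"
    and [measurable]: "(\<lambda>(s, y). G s y) \<in> borel_measurable (S \<Otimes>\<^sub>M lborel)"
      "(\<lambda>(s, y). f s y) \<in> borel_measurable (S \<Otimes>\<^sub>M lborel)"
      "A \<in> borel_measurable S" "B \<in> borel_measurable S" "v \<in> borel_measurable lborel"
    and exps: "a \<ge> 1" "r \<ge> 1" "q \<ge> 1" "1 + 1/q = 1/a + 1/r"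
    and pos: "\<And>s y. 0 \<le> G s y" "\<And>s y. 0 \<le> f s y" "\<And>s. s \<in> space S \<Longrightarrow> 0 < A s"
      "\<And>s. s \<in> space S \<Longrightarrow> 0 < B s" "\<And>x. 0 \<le> v x" "0 < D"
    and GA: "\<And>s. s \<in> space S \<Longrightarrow> (\<integral>\<^sup>+z. ennreal (G s z powr a) \<partial>lborel) \<le> ennreal (A s)"
    and fB: "\<And>s. s \<in> space S \<Longrightarrow> (\<integral>\<^sup>+z. ennreal (f s z powr r) \<partial>lborel) \<le> ennreal (B s)"
    and D: "(\<integral>\<^sup>+s. ennreal (A s powr (1/a) * B s powr (1/r)) \<partial>S) \<le> ennreal D"
    and v: "AE x in lborel. ennreal (v x) \<le> (\<integral>\<^sup>+s. (\<integral>\<^sup>+y. ennreal (G s (x - y) * f s y) \<partial>lborel) \<partial>S)"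
  shows "(\<integral>\<^sup>+x. ennreal (v x powr q) \<partial>lborel) \<le> ennreal ((2 * D) powr q)"
proof -
  interpret S: sigma_finite_measure S by fact
  interpret P: pair_sigma_finite S "lborel :: 'a measure" ..
  interpret Q: pair_sigma_finite "S \<Otimes>\<^sub>M (lborel :: 'a measure)" "lborel :: 'a measure" ..
  define b where "b s = A s powr (1/a) * B s powr (1/r)" for s
  define g where "g s z = G s z powr a / A s" for s z
  define h where "h s z = f s z powr r / B s" for s z
  have [measurable]: "b \<in> borel_measurable S" "(\<lambda>(s, y). g s y) \<in> borel_measurable (S \<Otimes>\<^sub>M lborel)"
    "(\<lambda>(s, y). h s y) \<in> borel_measurable (S \<Otimes>\<^sub>M lborel)"
    unfolding b_def g_def h_def by measurable
  have b_nn: "0 \<le> b s" for s by (simp add: b_def)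
  have g_nn: "0 \<le> g s y" and h_nn: "0 \<le> h s y" if "s \<in> space S" for s y
    using pos(3,4)[OF that] by (auto simp: g_def h_def)
  have g1: "(\<integral>\<^sup>+z. ennreal (g s z) \<partial>lborel) \<le> 1" if "s \<in> space S" for s
  proof -
    have [measurable]: "G s \<in> borel_measurable borel"
      using measurable_Pair2[OF assms(2) that] by simp
    have "(\<integral>\<^sup>+z. ennreal (g s z) \<partial>lborel) = (\<integral>\<^sup>+z. ennreal (G s z powr a) \<partial>lborel) / ennreal (A s)"
      using pos(3)[OF that] by (simp add: g_def nn_integral_divide divide_ennreal[symmetric])
    also have "\<dots> \<le> ennreal (A s) / ennreal (A s)"
      using GA[OF that] by (rule divide_right_mono_ennreal)
    also have "\<dots> = 1" using pos(3)[OF that] by (simp add: divide_ennreal)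
    finally show ?thesis .
  qed
  have h1: "(\<integral>\<^sup>+z. ennreal (h s z) \<partial>lborel) \<le> 1" if "s \<in> space S" for s
  proof -
    have [measurable]: "f s \<in> borel_measurable borel"
      using measurable_Pair2[OF assms(3) that] by simp
    have "(\<integral>\<^sup>+z. ennreal (h s z) \<partial>lborel) = (\<integral>\<^sup>+z. ennreal (f s z powr r) \<partial>lborel) / ennreal (B s)"
      using pos(4)[OF that] by (simp add: h_def nn_integral_divide divide_ennreal[symmetric])
    also have "\<dots> \<le> ennreal (B s) / ennreal (B s)"
      using fB[OF that] by (rule divide_right_mono_ennreal)
    also have "\<dots> = 1" using pos(4)[OF that] by (simp add: divide_ennreal)
    finally show ?thesis .
  qed
  have gx1: "(\<integral>\<^sup>+y. ennreal (g s (x - y)) \<partial>lborel) \<le> 1" if "s \<in> space S" for s x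
  proof -
    have "g s \<in> borel_measurable borel"
      using measurable_Pair2[OF \<open>(\<lambda>(s, y). g s y) \<in> borel_measurable (S \<Otimes>\<^sub>M lborel)\<close> that] by simp
    then show ?thesis
      using g1[OF that] by (subst nn_integral_lborel_diff) simp_all
  qed
  have Gf: "G s z * f s y = b s * (g s z powr (1/a) * h s y powr (1/r))" if "s \<in> space S" for s z y
    using pos(1,2)[of s] pos(3,4)[OF that] exps by (simp add: b_def g_def h_def powr_divide powr_powr)
  define J where "J x = (\<integral>\<^sup>+w. ennreal (b (fst w) * (g (fst w) (x - snd w) * h (fst w) (snd w))) \<partial>(S \<Otimes>\<^sub>M lborel))" for x
  have J: "AE x in lborel. ennreal (v x powr q) \<le> ennreal ((2 * D) powr (q - 1)) * J x"
  proof (cases "q = 1")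
    case True
    with exps have ar: "a = 1" "r = 1"
    proof -
      have "1/a \<le> 1" "1/r \<le> 1" using exps by auto
      moreover have "1/a + 1/r = 2" using exps(4) True by simp
      ultimately have "1/a = 1" "1/r = 1" by linarith+
      then show "a = 1" "r = 1" by auto
    qed
    from v show ?thesis
    proof eventually_elim
      case (elim x)
      have "(\<integral>\<^sup>+s. (\<integral>\<^sup>+y. ennreal (G s (x - y) * f s y) \<partial>lborel) \<partial>S)
          = (\<integral>\<^sup>+s. (\<integral>\<^sup>+y. ennreal (b s * (g s (x - y) * h s y)) \<partial>lborel) \<partial>S)"
        using g_nn h_nn by (intro nn_integral_cong) (simp add: Gf ar)
      also have "\<dots> = J x"
        unfolding J_def by (subst lborel.nn_integral_fst[symmetric]) auto
      finally show ?case using elim True pos by simp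
    qed
  next
    case False
    with exps have q: "q > 1" by simp
    define q' where "q' = q / (q - 1)"
    have q': "q' > 1" "1/q + 1/q' = 1" using q by (auto simp: q'_def field_simps)
    define \<theta> where "\<theta> = q' * (1/a - 1/q)"
    have \<theta>1: "1 - \<theta> = q' * (1/r - 1/q)"
    proof -
      have "\<theta> + q' * (1/r - 1/q) = q' * (1/a + 1/r - 2 * (1/q))" by (simp add: \<theta>_def algebra_simps)
      also have "1/a + 1/r - 2 * (1/q) = 1/q'" using exps(4) q' by linarith
      finally show ?thesis using q' by simp
    qed
    have "1/a \<le> 1" "1/r \<le> 1" using exps by auto
    then have "1/a - 1/q \<ge> 0" "1/r - 1/q \<ge> 0" using exps by linarith+
    then have \<theta>: "0 \<le> \<theta>" "\<theta> \<le> 1" using \<theta>1 q' by (auto simp: \<theta>_def) (smt (verit) mult_nonneg_nonneg)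
    from v show ?thesis
    proof eventually_elim
      case (elim x)
      let ?g = "\<lambda>w. \<bar>g (fst w) (x - snd w)\<bar>" and ?h = "\<lambda>w. \<bar>h (fst w) (snd w)\<bar>"
      let ?F = "\<lambda>w. (b (fst w) * (?g w * ?h w)) powr (1/q)"
      let ?H = "\<lambda>w. (b (fst w) * (?g w powr \<theta> * ?h w powr (1 - \<theta>))) powr (1/q')"
      have FH: "G (fst w) (x - snd w) * f (fst w) (snd w) = ?F w * ?H w" if "fst w \<in> space S" for w
      proof -
        have bb: "b (fst w) = b (fst w) powr (1/q) * b (fst w) powr (1/q')"
          using q' b_nn by (simp flip: powr_add)
        have e1: "1/q + \<theta> * (1/q') = 1/a" and e2: "1/q + (1 - \<theta>) * (1/q') = 1/r"
          using q' unfolding \<theta>1 by (auto simp: \<theta>_def)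
        have "?F w * ?H w = (b (fst w) powr (1/q) * b (fst w) powr (1/q')) * 
            (?g w powr (1/q + \<theta> * (1/q')) * ?h w powr (1/q + (1 - \<theta>) * (1/q')))"
          using b_nn by (simp add: powr_mult powr_powr powr_add)
        also have "\<dots> = b (fst w) * (?g w powr (1/a) * ?h w powr (1/r))"
          unfolding e1 e2 by (subst bb) simp
        finally show ?thesis using Gf[OF that] g_nn[OF that] h_nn[OF that] by simp
      qed
      have "ennreal (v x powr q) \<le> ennreal ((2 * D) powr (q - 1)) * (\<integral>\<^sup>+w. ennreal (?F w powr q) \<partial>(S \<Otimes>\<^sub>M lborel))"
      proof (rule powr_le_nn_integral_Holder[OF q q'])
        have "(\<integral>\<^sup>+s. (\<integral>\<^sup>+y. ennreal (G s (x - y) * f s y) \<partial>lborel) \<partial>S)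
            = (\<integral>\<^sup>+s. (\<integral>\<^sup>+y. ennreal (?F (s, y) * ?H (s, y)) \<partial>lborel) \<partial>S)"
          using FH[of "(_, _)"] by (intro nn_integral_cong) simp
        also have "\<dots> = (\<integral>\<^sup>+w. ennreal (?F w * ?H w) \<partial>(S \<Otimes>\<^sub>M lborel))"
          by (subst lborel.nn_integral_fst[symmetric]) auto
        finally show "ennreal (v x) \<le> (\<integral>\<^sup>+w. ennreal (?F w * ?H w) \<partial>(S \<Otimes>\<^sub>M lborel))" using elim by simp
        have "(\<integral>\<^sup>+w. ennreal (?H w powr q') \<partial>(S \<Otimes>\<^sub>M lborel)) \<le> (\<integral>\<^sup>+w. ennreal (b (fst w) * (?g w + ?h w)) \<partial>(S \<Otimes>\<^sub>M lborel))"
          using \<theta> q' b_nn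
          by (intro nn_integral_mono ennreal_leI) (auto simp: powr_powr intro!: mult_left_mono powr_mult_powr_le_add)
        also have "\<dots> = (\<integral>\<^sup>+s. (\<integral>\<^sup>+y. ennreal (b s * (\<bar>g s (x - y)\<bar> + \<bar>h s y\<bar>)) \<partial>lborel) \<partial>S)"
          by (subst lborel.nn_integral_fst[symmetric]) auto
        also have "\<dots> \<le> (\<integral>\<^sup>+s. ennreal (b s) * 2 \<partial>S)"
        proof (rule nn_integral_mono)
          fix s assume s: "s \<in> space S"
          have [measurable]: "g s \<in> borel_measurable borel" "h s \<in> borel_measurable borel"
            using measurable_Pair2[OF \<open>(\<lambda>(s, y). g s y) \<in> borel_measurable (S \<Otimes>\<^sub>M lborel)\<close> s]
              measurable_Pair2[OF \<open>(\<lambda>(s, y). h s y) \<in> borel_measurable (S \<Otimes>\<^sub>M lborel)\<close> s] by simp_all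
          have "(\<integral>\<^sup>+y. ennreal (b s * (\<bar>g s (x - y)\<bar> + \<bar>h s y\<bar>)) \<partial>lborel)
              = ennreal (b s) * ((\<integral>\<^sup>+y. ennreal (g s (x - y)) \<partial>lborel) + (\<integral>\<^sup>+y. ennreal (h s y) \<partial>lborel))"
            using g_nn[OF s] h_nn[OF s] b_nn
            by (simp add: ennreal_mult ennreal_plus nn_integral_cmult nn_integral_add)
          also have "\<dots> \<le> ennreal (b s) * (1 + 1)"
            using gx1[OF s] h1[OF s] by (intro mult_left_mono add_mono) auto
          finally show "(\<integral>\<^sup>+y. ennreal (b s * (\<bar>g s (x - y)\<bar> + \<bar>h s y\<bar>)) \<partial>lborel) \<le> ennreal (b s) * 2"
            by simp
        qed
        also have "\<dots> = (\<integral>\<^sup>+s. ennreal (b s) \<partial>S) * 2"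
          by (simp add: nn_integral_multc)
        also have "\<dots> \<le> ennreal D * 2"
          using D by (intro mult_right_mono) (auto simp: b_def)
        also have "\<dots> = ennreal (2 * D)"
          using pos by (simp add: ennreal_mult mult.commute)
        finally show "(\<integral>\<^sup>+w. ennreal (?H w powr q') \<partial>(S \<Otimes>\<^sub>M lborel)) \<le> ennreal (2 * D)" .
      qed (use pos in auto)
      also have "(\<integral>\<^sup>+w. ennreal (?F w powr q) \<partial>(S \<Otimes>\<^sub>M lborel)) = J x"
        unfolding J_def using q b_nn g_nn h_nn
        by (intro nn_integral_cong) (auto simp: powr_powr space_pair_measure)
      finally show ?case .
    qed
  qed
  have "(\<integral>\<^sup>+x. J x \<partial>lborel) \<le> ennreal D"
  proof -
    have "(\<integral>\<^sup>+x. J x \<partial>lborel) = (\<integral>\<^sup>+w. (\<integral>\<^sup>+x. ennreal (b (fst w) * (g (fst w) (x - snd w) * h (fst w) (snd w))) \<partial>lborel) \<partial>(S \<Otimes>\<^sub>M lborel))"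
      unfolding J_def by (intro Q.Fubini') measurable
    also have "\<dots> \<le> (\<integral>\<^sup>+w. ennreal (b (fst w)) * ennreal (h (fst w) (snd w)) \<partial>(S \<Otimes>\<^sub>M lborel))"
    proof (rule nn_integral_mono)
      fix w assume "w \<in> space (S \<Otimes>\<^sub>M (lborel :: 'a measure))"
      then have s: "fst w \<in> space S" by (auto simp: space_pair_measure)
      have [measurable]: "g (fst w) \<in> borel_measurable borel"
        using measurable_Pair2[OF \<open>(\<lambda>(s, y). g s y) \<in> borel_measurable (S \<Otimes>\<^sub>M lborel)\<close> s] by simp
      have "(\<integral>\<^sup>+x. ennreal (b (fst w) * (g (fst w) (x - snd w) * h (fst w) (snd w))) \<partial>lborel)
          = ennreal (b (fst w)) * ((\<integral>\<^sup>+x. ennreal (g (fst w) (x - snd w)) \<partial>lborel) * ennreal (h (fst w) (snd w)))"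
        using g_nn[OF s] h_nn[OF s] b_nn by (simp add: ennreal_mult nn_integral_cmult nn_integral_multc)
      also have "(\<integral>\<^sup>+x. ennreal (g (fst w) (x - snd w)) \<partial>lborel) \<le> 1"
        using g1[OF s] by (subst nn_integral_lborel_diff') simp_all
      finally show "(\<integral>\<^sup>+x. ennreal (b (fst w) * (g (fst w) (x - snd w) * h (fst w) (snd w))) \<partial>lborel)
          \<le> ennreal (b (fst w)) * ennreal (h (fst w) (snd w))"
        by (simp add: mult_left_mono mult_right_mono)
    qed
    also have "\<dots> = (\<integral>\<^sup>+s. (\<integral>\<^sup>+y. ennreal (b s) * ennreal (h s y) \<partial>lborel) \<partial>S)"
      by (subst lborel.nn_integral_fst[symmetric]) auto
    also have "\<dots> \<le> (\<integral>\<^sup>+s. ennreal (b s) * 1 \<partial>S)"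
    proof (rule nn_integral_mono)
      fix s assume s: "s \<in> space S"
      have [measurable]: "h s \<in> borel_measurable borel"
        using measurable_Pair2[OF \<open>(\<lambda>(s, y). h s y) \<in> borel_measurable (S \<Otimes>\<^sub>M lborel)\<close> s] by simp
      show "(\<integral>\<^sup>+y. ennreal (b s) * ennreal (h s y) \<partial>lborel) \<le> ennreal (b s) * 1"
        using mult_left_mono[OF h1[OF s], of "ennreal (b s)"] by (simp add: nn_integral_cmult)
    qed
    also have "\<dots> \<le> ennreal D" using D by (simp add: b_def)
    finally show ?thesis .
  qed
  moreover have [measurable]: "J \<in> borel_measurable lborel"
    unfolding J_def by measurable
  ultimately have "(\<integral>\<^sup>+x. ennreal (v x powr q) \<partial>lborel) \<le> ennreal ((2 * D) powr (q - 1)) * ennreal D"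
    using nn_integral_mono_AE[OF J] by (simp add: nn_integral_cmult) (meson mult_left_mono order.trans zero_le)
  also have "\<dots> \<le> ennreal ((2 * D) powr (q - 1) * (2 * D) powr 1)"
    using pos by (simp flip: ennreal_mult')
  also have "(2 * D) powr (q - 1) * (2 * D) powr 1 = (2 * D) powr q"
    by (simp only: powr_add[symmetric]) simp
  finally show ?thesis .
qed

lemma nn_integral_powr_le_of_Lp_norm:
  assumes "in_Lp p f" "p > 0" "K \<ge> 0" "Lp_norm p f \<le> K"
  shows "(\<integral>\<^sup>+x. ennreal (\<bar>f x\<bar> powr p) \<partial>lborel) \<le> ennreal (K powr p)"
proof -
  let ?I = "\<integral>x. \<bar>f x\<bar> powr p \<partial>lborel"
  have "?I = (?I powr (1/p)) powr p" using assms by (simp add: powr_powr Bochner_Integration.integral_nonneg)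
  also have "\<dots> \<le> K powr p" using assms by (intro powr_mono2) (auto simp: Lp_norm_def)
  finally show ?thesis using assms
    by (subst nn_integral_eq_integral) (auto simp: in_Lp_def intro: ennreal_leI)
qed

lemma Lp_norm_le_of_nn_integral_powr:
  assumes [measurable]: "f \<in> borel_measurable lborel" and "p > 0" "c \<ge> 0"
    and c: "(\<integral>\<^sup>+x. ennreal (\<bar>f x\<bar> powr p) \<partial>lborel) \<le> ennreal c"
  shows "in_Lp p f \<and> Lp_norm p f \<le> c powr (1/p)"
proof
  have "(\<integral>\<^sup>+x. ennreal (\<bar>f x\<bar> powr p) \<partial>lborel) < \<infinity>"
    using c by (simp add: order_le_less_trans)
  then have int: "integrable lborel (\<lambda>x. \<bar>f x\<bar> powr p)"
    by (intro integrableI_nonneg) auto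
  then show "in_Lp p f" by (simp add: in_Lp_def)
  have "ennreal (\<integral>x. \<bar>f x\<bar> powr p \<partial>lborel) \<le> ennreal c"
    using c int by (subst (asm) nn_integral_eq_integral) auto
  then have "(\<integral>x. \<bar>f x\<bar> powr p \<partial>lborel) \<le> c" using \<open>c \<ge> 0\<close> by simp
  then show "Lp_norm p f \<le> c powr (1/p)"
    unfolding Lp_norm_def using \<open>p > 0\<close> by (intro powr_mono2) (auto intro: Bochner_Integration.integral_nonneg)
qed

lemma powr_add_le:
  fixes x y q :: real
  assumes "0 \<le> x" "0 \<le> y" "0 \<le> q"
  shows "(x + y) powr q \<le> 2 powr q * (x powr q + y powr q)"
proof -
  have "(x + y) powr q \<le> (2 * max x y) powr q"
    using assms by (intro powr_mono2) auto
  also have "\<dots> = 2 powr q * (max x y) powr q" using assms by (simp add: powr_mult)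
  also have "\<dots> \<le> 2 powr q * (x powr q + y powr q)"
    by (intro mult_left_mono) (auto simp: max_def)
  finally show ?thesis .
qed

lemma ennreal_max_diff_le:
  assumes "ennreal a \<le> ennreal h + X" "0 \<le> h"
  shows "ennreal (max 0 (a - h)) \<le> X"
proof (cases X)
  case (real x)
  then have "a \<le> h + x" using assms by (metis add_nonneg_nonneg ennreal_le_iff ennreal_plus)
  then show ?thesis using real by (auto intro!: ennreal_leI)
qed simp

section \<open>Power kernels and the heat kernel in the plane\<close>

lemma distr_norm_lborel_R2:
  "distr (lborel :: R2 measure) borel norm = density lborel (\<lambda>\<rho>. ennreal (2 * pi * \<rho>))"
proof (rule measure_eqI_generator_eq[where E = "range lessThan" and \<Omega> = UNIV and A = "\<lambda>i::nat. {..<real i}"])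
  show "Int_stable (range lessThan :: real set set)"
  proof (rule Int_stableI)
    fix a b :: "real set" assume "a \<in> range lessThan" "b \<in> range lessThan"
    then obtain x y where "a = {..<x}" "b = {..<y}" by auto
    then have "a \<inter> b = {..<min x y}" by auto
    then show "a \<inter> b \<in> range lessThan" by blast
  qed
  have disk: "emeasure (distr (lborel :: R2 measure) borel norm) {..<x} = ennreal (pi * (max 0 x)\<^sup>2)" for x
  proof -
    have "emeasure (distr (lborel :: R2 measure) borel norm) {..<x} = emeasure lborel (ball (0::R2) (max 0 x))"
    proof -
      have "norm -` {..<x} \<inter> space lborel = ball (0::R2) (max 0 x)"
        using norm_ge_zero by (auto simp: less_max_iff_disj simp: not_less)
      then show ?thesis by (subst emeasure_distr) auto
    qed
    then show ?thesis by (simp add: emeasure_ball unit_ball_vol_2)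
  qed
  fix X :: "real set" assume "X \<in> range lessThan"
  then obtain x where X: "X = {..<x}" by auto
  have "((\<lambda>\<rho>. 2 * pi * \<rho> powr 1) has_integral 2 * pi * ((max 0 x) powr (1 + 1) / (1 + 1))) {0..max 0 x}"
    by (intro has_integral_mult_right has_integral_powr_from_0) auto
  then have "(\<integral>\<^sup>+\<rho>. ennreal (2 * pi * \<rho> powr 1) * indicator {0..max 0 x} \<rho> \<partial>lborel)
      = ennreal (2 * pi * ((max 0 x) powr (1 + 1) / (1 + 1)))"
    by (intro nn_integral_has_integral_lebesgue') auto
  also have "(\<integral>\<^sup>+\<rho>. ennreal (2 * pi * \<rho> powr 1) * indicator {0..max 0 x} \<rho> \<partial>lborel)
      = (\<integral>\<^sup>+\<rho>. ennreal (2 * pi * \<rho>) * indicator X \<rho> \<partial>lborel)"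
    using AE_lborel_singleton[of x] AE_lborel_singleton[of "0::real"]
    by (intro nn_integral_cong_AE, elim AE_mp)
       (auto simp: X ennreal_neg mult_nonneg_nonpos split: split_indicator)
  finally have "(\<integral>\<^sup>+\<rho>. ennreal (2 * pi * \<rho>) * indicator X \<rho> \<partial>lborel) = ennreal (pi * (max 0 x)\<^sup>2)"
    by simp
  then show "emeasure (distr (lborel :: R2 measure) borel norm) X = emeasure (density lborel (\<lambda>\<rho>. ennreal (2 * pi * \<rho>))) X"
    by (subst emeasure_density) (auto simp: X disk)
next
  show "sets (distr (lborel :: R2 measure) borel norm) = sigma_sets UNIV (range lessThan)"
    by (simp add: borel_Iio)
  show "sets (density lborel (\<lambda>\<rho>. ennreal (2 * pi * \<rho>))) = sigma_sets UNIV (range lessThan)"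
    by (simp add: borel_Iio)
  show "(\<Union>i. {..<real i}) = UNIV" by (auto intro: reals_Archimedean2)
  fix i :: nat
  show "emeasure (distr (lborel :: R2 measure) borel norm) {..<real i} \<noteq> \<infinity>"
  proof -
    have "emeasure (distr (lborel :: R2 measure) borel norm) {..<real i} = emeasure lborel (ball (0::R2) (real i))"
      by (subst emeasure_distr) (auto intro!: arg_cong[where f = "emeasure lborel"])
    then show ?thesis by (simp add: emeasure_ball)
  qed
qed auto

lemma nn_integral_norm_R2:
  assumes [measurable]: "h \<in> borel_measurable borel"
  shows "(\<integral>\<^sup>+z. h (norm (z::R2)) \<partial>lborel) = (\<integral>\<^sup>+\<rho>. ennreal (2 * pi * \<rho>) * h \<rho> \<partial>lborel)"
proof -
  have "(\<integral>\<^sup>+z. h (norm (z::R2)) \<partial>lborel) = (\<integral>\<^sup>+\<rho>. h \<rho> \<partial>distr (lborel :: R2 measure) borel norm)"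
    by (subst nn_integral_distr) auto
  then show ?thesis by (simp add: distr_norm_lborel_R2 nn_integral_density)
qed

lemma nn_integral_norm_powr_ball:
  assumes "a < 2" "R \<ge> 0"
  shows "(\<integral>\<^sup>+z. ennreal (norm (z::R2) powr (- a)) * indicator (ball 0 R) z \<partial>lborel)
    \<le> ennreal (2 * pi / (2 - a) * R powr (2 - a))"
proof -
  have "(\<integral>\<^sup>+z. ennreal (norm (z::R2) powr (- a)) * indicator (ball 0 R) z \<partial>lborel)
      = (\<integral>\<^sup>+z. ennreal (norm (z::R2) powr (- a)) * indicator {..<R} (norm z) \<partial>lborel)"
    by (intro nn_integral_cong) (auto split: split_indicator)
  also have "\<dots> = (\<integral>\<^sup>+\<rho>. ennreal (2 * pi * \<rho>) * (ennreal (\<rho> powr (- a)) * indicator {..<R} \<rho>) \<partial>lborel)"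
    by (subst nn_integral_norm_R2) auto
  also have "\<dots> \<le> (\<integral>\<^sup>+\<rho>. ennreal (2 * pi * \<rho> powr (1 - a)) * indicator {0..R} \<rho> \<partial>lborel)"
  proof (rule nn_integral_mono)
    fix \<rho> :: real
    show "ennreal (2 * pi * \<rho>) * (ennreal (\<rho> powr (- a)) * indicator {..<R} \<rho>)
        \<le> ennreal (2 * pi * \<rho> powr (1 - a)) * indicator {0..R} \<rho>"
    proof (cases "\<rho> > 0")
      case True
      then have "\<rho> * \<rho> powr (- a) = \<rho> powr (1 - a)" by (simp add: powr_diff powr_minus_divide)
      with True show ?thesis by (auto split: split_indicator simp flip: ennreal_mult')
    qed (auto simp: ennreal_neg mult_nonneg_nonpos)
  qed
  also have "\<dots> = ennreal (2 * pi * (R powr ((1 - a) + 1) / ((1 - a) + 1)))"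
    using assms by (intro nn_integral_has_integral_lebesgue' has_integral_mult_right has_integral_powr_from_0) auto
  finally show ?thesis by (simp add: algebra_simps)
qed

lemma nn_integral_norm_powr_outside_ball:
  assumes "a > 2" "R > 0"
  shows "(\<integral>\<^sup>+z. ennreal (norm (z::R2) powr (- a)) * indicator (- ball 0 R) z \<partial>lborel)
    \<le> ennreal (2 * pi / (a - 2) * R powr (2 - a))"
proof -
  have "(\<integral>\<^sup>+z. ennreal (norm (z::R2) powr (- a)) * indicator (- ball 0 R) z \<partial>lborel)
      = (\<integral>\<^sup>+z. ennreal (norm (z::R2) powr (- a)) * indicator {R..} (norm z) \<partial>lborel)"
    by (intro nn_integral_cong) (auto split: split_indicator)
  also have "\<dots> = (\<integral>\<^sup>+\<rho>. ennreal (2 * pi * \<rho>) * (ennreal (\<rho> powr (- a)) * indicator {R..} \<rho>) \<partial>lborel)"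
    by (subst nn_integral_norm_R2) auto
  also have "\<dots> = (\<integral>\<^sup>+\<rho>. ennreal (2 * pi * \<rho> powr (1 - a)) * indicator {R..} \<rho> \<partial>lborel)"
  proof (rule nn_integral_cong)
    fix \<rho> :: real
    show "ennreal (2 * pi * \<rho>) * (ennreal (\<rho> powr (- a)) * indicator {R..} \<rho>)
        = ennreal (2 * pi * \<rho> powr (1 - a)) * indicator {R..} \<rho>"
    proof (cases "\<rho> \<ge> R")
      case True
      then have "\<rho> * \<rho> powr (- a) = \<rho> powr (1 - a)" using assms by (simp add: powr_diff powr_minus_divide)
      with True assms show ?thesis by (auto split: split_indicator simp flip: ennreal_mult')
    qed auto
  qed
  also have "\<dots> = ennreal (2 * pi * (- (R powr ((1 - a) + 1)) / ((1 - a) + 1)))"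
    using assms by (intro nn_integral_has_integral_lebesgue' has_integral_mult_right has_integral_powr_to_inf) auto
  also have "2 * pi * (- (R powr ((1 - a) + 1)) / ((1 - a) + 1)) = 2 * pi / (a - 2) * R powr (2 - a)"
    using assms by (simp add: divide_simps) (simp add: algebra_simps)
  finally show ?thesis by simp
qed

lemma nn_integral_decay_powr:
  fixes w :: "R2 \<Rightarrow> real"
  assumes "a > 0" "m * a > 2" "P \<ge> 0" "d > 0"
    and "\<And>z. 0 \<le> w z" "\<And>z. w z \<le> P" "\<And>z. norm z \<ge> d \<Longrightarrow> w z \<le> P * (d / norm z) powr m"
  shows "(\<integral>\<^sup>+z. ennreal (w z powr a) \<partial>lborel) \<le> ennreal ((pi + 2 * pi / (m * a - 2)) * P powr a * d\<^sup>2)"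
proof -
  have b[measurable]: "ball 0 d \<in> sets (lborel :: R2 measure)" "- ball 0 d \<in> sets (lborel :: R2 measure)"
    by (simp_all add: borel_closed closed_Compl)
  have [measurable]: "(\<lambda>z::R2. ennreal (norm z powr (- (m * a))) * indicator (- ball 0 d) z) \<in> borel_measurable lborel"
    by measurable
  have pw: "ennreal (w z powr a) \<le> ennreal (P powr a) * indicator (ball 0 d) z
      + ennreal (P powr a * d powr (m * a)) * (ennreal (norm z powr (- (m * a))) * indicator (- ball 0 d) z)" for z
  proof (cases "norm z < d")
    case True
    then show ?thesis using assms(1,5,6) by (auto intro!: ennreal_leI powr_mono2)
  next
    case False
    then have z: "norm z > 0" using assms by linarith
    have "w z powr a \<le> (P * (d / norm z) powr m) powr a"
      using False assms by (intro powr_mono2) auto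
    also have "\<dots> = P powr a * d powr (m * a) * norm z powr (- (m * a))"
      using assms z by (simp add: powr_mult powr_powr powr_divide powr_minus_divide)
    finally show ?thesis using False by (auto simp flip: ennreal_mult')
  qed
  have "(\<integral>\<^sup>+z. ennreal (w z powr a) \<partial>lborel) \<le> (\<integral>\<^sup>+z. ennreal (P powr a) * indicator (ball 0 d) z
      + ennreal (P powr a * d powr (m * a)) * (ennreal (norm (z::R2) powr (- (m * a))) * indicator (- ball 0 d) z) \<partial>lborel)"
    by (rule nn_integral_mono) (rule pw)
  also have "\<dots> = ennreal (P powr a) * emeasure lborel (ball (0::R2) d) + ennreal (P powr a * d powr (m * a)) *
      (\<integral>\<^sup>+z. ennreal (norm (z::R2) powr (- (m * a))) * indicator (- ball 0 d) z \<partial>lborel)"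
    using b by (simp add: nn_integral_add nn_integral_cmult del: ennreal_mult')
  also have "\<dots> \<le> ennreal (P powr a) * ennreal (pi * d\<^sup>2) + ennreal (P powr a * d powr (m * a)) *
      ennreal (2 * pi / (m * a - 2) * d powr (2 - m * a))"
    using assms by (intro add_mono mult_left_mono nn_integral_norm_powr_outside_ball)
      (auto simp: emeasure_ball unit_ball_vol_2)
  also have "\<dots> = ennreal (P powr a * (pi * d\<^sup>2) + P powr a * d powr (m * a) * (2 * pi / (m * a - 2) * d powr (2 - m * a)))"
    using assms by (simp flip: ennreal_mult' ennreal_plus)
  also have "P powr a * (pi * d\<^sup>2) + P powr a * d powr (m * a) * (2 * pi / (m * a - 2) * d powr (2 - m * a))
     = (pi + 2 * pi / (m * a - 2)) * P powr a * d\<^sup>2"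
  proof -
    have "d powr (m * a) * d powr (2 - m * a) = d\<^sup>2"
      using assms by (simp flip: powr_add)
    then have "P powr a * d powr (m * a) * (2 * pi / (m * a - 2) * d powr (2 - m * a)) = P powr a * (2 * pi / (m * a - 2)) * d\<^sup>2"
      by (simp add: mult.assoc mult.left_commute)
    then show ?thesis by (simp add: algebra_simps)
  qed
  finally show ?thesis .
qed

lemma nn_integral_powr_atMost:
  fixes a :: real
  assumes "a < 1" "t \<ge> 0"
  shows "(\<integral>\<^sup>+s. ennreal (s powr (- a)) * indicator {0..t} s \<partial>lborel) = ennreal (t powr (1 - a) / (1 - a))"
proof -
  have "(\<integral>\<^sup>+s. ennreal (s powr (- a)) * indicator {0..t} s \<partial>lborel) = ennreal (t powr (- a + 1) / (- a + 1))"
    using assms by (intro nn_integral_has_integral_lebesgue' has_integral_powr_from_0) auto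
  then show ?thesis by simp
qed

lemma nn_integral_beta_le:
  fixes \<alpha> \<beta> t :: real
  assumes "0 \<le> \<alpha>" "\<alpha> < 1" "0 \<le> \<beta>" "\<beta> < 1" "t > 0"
  shows "(\<integral>\<^sup>+s. ennreal ((t - s) powr (- \<alpha>) * s powr (- \<beta>)) \<partial>restrict_space lborel {0<..<t})
    \<le> ennreal ((2 powr \<alpha> / (1 - \<beta>) + 2 powr \<beta> / (1 - \<alpha>)) * t powr (1 - \<alpha> - \<beta>))"
proof -
  have "(\<integral>\<^sup>+s. ennreal ((t - s) powr (- \<alpha>) * s powr (- \<beta>)) \<partial>restrict_space lborel {0<..<t})
      = (\<integral>\<^sup>+s. ennreal ((t - s) powr (- \<alpha>) * s powr (- \<beta>)) * indicator {0<..<t} s \<partial>lborel)"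
    by (subst nn_integral_restrict_space) auto
  also have "\<dots> \<le> (\<integral>\<^sup>+s. ennreal ((t/2) powr (- \<alpha>)) * (ennreal (s powr (- \<beta>)) * indicator {0..t} s)
      + ennreal ((t/2) powr (- \<beta>)) * (ennreal ((t - s) powr (- \<alpha>)) * indicator {0..t} (t - s)) \<partial>lborel)"
  proof (rule nn_integral_mono)
    fix s
    show "ennreal ((t - s) powr (- \<alpha>) * s powr (- \<beta>)) * indicator {0<..<t} s
      \<le> ennreal ((t/2) powr (- \<alpha>)) * (ennreal (s powr (- \<beta>)) * indicator {0..t} s)
      + ennreal ((t/2) powr (- \<beta>)) * (ennreal ((t - s) powr (- \<alpha>)) * indicator {0..t} (t - s))"
    proof (cases "s \<in> {0<..<t}")
      case True
      have "(t - s) powr (- \<alpha>) * s powr (- \<beta>) \<le> (t/2) powr (- \<alpha>) * s powr (- \<beta>) + (t/2) powr (- \<beta>) * (t - s) powr (- \<alpha>)"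
      proof (cases "s \<le> t / 2")
        case True
        with \<open>s \<in> _\<close> assms have "(t - s) powr (- \<alpha>) \<le> (t/2) powr (- \<alpha>)"
          by (intro powr_mono2') auto
        then have "(t - s) powr (- \<alpha>) * s powr (- \<beta>) \<le> (t/2) powr (- \<alpha>) * s powr (- \<beta>)"
          by (intro mult_right_mono) auto
        then show ?thesis by (simp add: add_increasing2)
      next
        case False
        with \<open>s \<in> _\<close> assms have "s powr (- \<beta>) \<le> (t/2) powr (- \<beta>)"
          by (intro powr_mono2') auto
        then have "(t - s) powr (- \<alpha>) * s powr (- \<beta>) \<le> (t - s) powr (- \<alpha>) * (t/2) powr (- \<beta>)"
          by (intro mult_left_mono) auto
        then show ?thesis by (simp add: add_increasing mult.commute)
      qed
      with True show ?thesis by (simp flip: ennreal_mult' ennreal_plus)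
    qed auto
  qed
  also have "\<dots> = ennreal ((t/2) powr (- \<alpha>)) * ennreal (t powr (1 - \<beta>) / (1 - \<beta>))
      + ennreal ((t/2) powr (- \<beta>)) * ennreal (t powr (1 - \<alpha>) / (1 - \<alpha>))"
    using nn_integral_lborel_diff[of "\<lambda>s. ennreal (s powr (- \<alpha>)) * indicator {0..t} s" t]
      nn_integral_powr_atMost[of \<alpha> t] nn_integral_powr_atMost[of \<beta> t] assms
    by (simp add: nn_integral_add nn_integral_cmult)
  also have "\<dots> = ennreal ((t/2) powr (- \<alpha>) * (t powr (1 - \<beta>) / (1 - \<beta>)) + (t/2) powr (- \<beta>) * (t powr (1 - \<alpha>) / (1 - \<alpha>)))"
    using assms by (simp flip: ennreal_mult' ennreal_plus)
  also have "(t/2) powr (- \<alpha>) * (t powr (1 - \<beta>) / (1 - \<beta>)) + (t/2) powr (- \<beta>) * (t powr (1 - \<alpha>) / (1 - \<alpha>))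
      = (2 powr \<alpha> / (1 - \<beta>) + 2 powr \<beta> / (1 - \<alpha>)) * t powr (1 - \<alpha> - \<beta>)"
  proof -
    have "(t/2) powr (- \<alpha>) * t powr (1 - \<beta>) = 2 powr \<alpha> * t powr (1 - \<alpha> - \<beta>)"
         "(t/2) powr (- \<beta>) * t powr (1 - \<alpha>) = 2 powr \<beta> * t powr (1 - \<alpha> - \<beta>)"
      using assms by (simp_all add: powr_divide powr_minus_divide powr_diff)
    then show ?thesis by (simp add: distrib_right)
  qed
  finally show ?thesis .
qed

lemma exp_minus_le_power2:
  fixes w :: real assumes "w > 0" shows "exp (- w) \<le> 2 / w\<^sup>2"
proof -
  have "w\<^sup>2 / 2 \<le> exp w" using exp_lower_Taylor_quadratic[of w] assms by simp
  then have "inverse (exp w) \<le> inverse (w\<^sup>2 / 2)" using assms by (intro le_imp_inverse_le) auto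
  then show ?thesis by (simp add: exp_minus field_simps)
qed

lemma heat_kernel_nonneg: "t > 0 \<Longrightarrow> 0 \<le> heat_kernel t z"
  by (simp add: heat_kernel_def)

lemma heat_kernel_le: "t > 0 \<Longrightarrow> heat_kernel t z \<le> 3 / t"
proof -
  assume t: "t > 0"
  have "heat_kernel t z \<le> 1 / (4 * pi * t)"
    using t by (auto simp: heat_kernel_def intro!: divide_right_mono)
  also have "\<dots> \<le> 3 / t"
    using t pi_gt3 by (auto simp: field_simps)
  finally show ?thesis .
qed

lemma heat_kernel_decay:
  assumes t: "t > 0" and z: "norm z \<ge> sqrt t"
  shows "heat_kernel t z \<le> 3 / t * (sqrt t / norm z) powr 4"
proof -
  have n: "norm z > 0" using t z real_sqrt_gt_zero[of t] by linarith
  have "exp (- (norm z)\<^sup>2 / (4 * t)) \<le> 2 / ((norm z)\<^sup>2 / (4 * t))\<^sup>2"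
    using exp_minus_le_power2[of "(norm z)\<^sup>2 / (4 * t)"] t n by simp
  also have "\<dots> = 32 * (t\<^sup>2 / norm z ^ 4)" using t n by (simp add: field_simps)
  finally have "heat_kernel t z \<le> 32 * (t\<^sup>2 / norm z ^ 4) / (4 * pi * t)"
    unfolding heat_kernel_def using t by (intro divide_right_mono) auto
  also have "\<dots> = 8 / pi * (t\<^sup>2 / norm z ^ 4) / t" by (simp add: field_simps)
  also have "\<dots> \<le> 3 * (t\<^sup>2 / norm z ^ 4) / t"
    using t n pi_gt3 by (intro divide_right_mono mult_right_mono) (auto simp: field_simps)
  also have "t\<^sup>2 / norm z ^ 4 = (sqrt t / norm z) powr 4"
  proof -
    have "sqrt t ^ 4 = t\<^sup>2" using t by (simp add: power4_eq_xxxx power2_eq_square)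
    then show ?thesis using t n by (simp add: powr_numeral power_divide)
  qed
  finally show ?thesis by simp
qed

lemma sqrt_divide_power2:
  fixes t :: real assumes t: "t > 0"
  shows "sqrt t / t\<^sup>2 = t powr (- 3/2)"
proof -
  have "t powr (- 3/2) = t powr (1/2 - 2)" by simp
  also have "\<dots> = sqrt t / t\<^sup>2" using t by (subst powr_diff) (simp add: powr_half_sqrt)
  finally show ?thesis by simp
qed

lemma norm_grad_heat_kernel:
  "t > 0 \<Longrightarrow> norm (grad_heat_kernel t z) = heat_kernel t z / (2 * t) * norm z"
  by (simp add: grad_heat_kernel_def heat_kernel_nonneg)

lemma norm_grad_heat_kernel_decay:
  assumes t: "t > 0" and z: "norm z \<ge> sqrt t"
  shows "norm (grad_heat_kernel t z) \<le> 2 * t powr (- 3/2) * (sqrt t / norm z) powr 3"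
proof -
  have n: "norm z > 0" using t z real_sqrt_gt_zero[of t] by linarith
  have "norm (grad_heat_kernel t z) \<le> 3 / t * (sqrt t / norm z) powr 4 / (2 * t) * norm z"
    unfolding norm_grad_heat_kernel[OF t] using heat_kernel_decay[OF assms] t
    by (intro mult_right_mono divide_right_mono) auto
  also have "\<dots> = 3 / 2 * (sqrt t / t\<^sup>2) * (sqrt t / norm z) powr 3"
    using t n by (simp add: powr_numeral field_simps power_numeral_reduce)
  also have "sqrt t / t\<^sup>2 = t powr (- 3/2)"
    by (rule sqrt_divide_power2[OF t])
  also have "3 / 2 * t powr (- 3/2) * (sqrt t / norm z) powr 3 \<le> 2 * t powr (- 3/2) * (sqrt t / norm z) powr 3"
    by (intro mult_right_mono) auto
  finally show ?thesis .
qed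

lemma norm_grad_heat_kernel_le:
  assumes t: "t > 0"
  shows "norm (grad_heat_kernel t z) \<le> 2 * t powr (- 3/2)"
proof (cases "norm z \<ge> sqrt t")
  case True
  have "sqrt t / norm z \<le> 1" using True t
    by (cases "norm z = 0") (auto simp: field_simps)
  then have "(sqrt t / norm z) powr 3 \<le> 1" using t by (intro powr_le1) auto
  then show ?thesis using norm_grad_heat_kernel_decay[OF t True]
    by (smt (verit) mult_left_le powr_ge_zero)
next
  case False
  have "norm (grad_heat_kernel t z) \<le> 3 / t / (2 * t) * sqrt t"
    unfolding norm_grad_heat_kernel[OF t] using heat_kernel_le[OF t] heat_kernel_nonneg[OF t] t False
    by (intro mult_mono divide_right_mono) auto
  also have "\<dots> = 3 / 2 * (sqrt t / t\<^sup>2)" using t by (simp add: power2_eq_square)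
  also have "sqrt t / t\<^sup>2 = t powr (- 3/2)"
    by (rule sqrt_divide_power2[OF t])
  finally show ?thesis using powr_ge_zero[of t "- 3/2"] by linarith
qed

lemma nn_integral_grad_heat_kernel_powr_le:
  assumes t: "t > 0" and a: "a \<ge> 1"
  shows "(\<integral>\<^sup>+z. ennreal (norm (grad_heat_kernel t z) powr a) \<partial>lborel)
    \<le> ennreal (3 * pi * 2 powr a * t powr (1 - 3/2 * a))"
proof -
  have "(\<integral>\<^sup>+z. ennreal (norm (grad_heat_kernel t z) powr a) \<partial>lborel)
      \<le> ennreal ((pi + 2 * pi / (3 * a - 2)) * (2 * t powr (- 3/2)) powr a * (sqrt t)\<^sup>2)"
    using assms norm_grad_heat_kernel_decay norm_grad_heat_kernel_le
    by (intro nn_integral_decay_powr) auto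
  also have "\<dots> \<le> ennreal (3 * pi * 2 powr a * t powr (1 - 3/2 * a))"
  proof (rule ennreal_leI)
    have "(2 * t powr (- 3/2)) powr a * (sqrt t)\<^sup>2 = 2 powr a * (t powr (- 3/2 * a) * t powr 1)"
      using t by (simp add: powr_mult powr_powr)
    also have "\<dots> = 2 powr a * t powr (1 - 3/2 * a)"
      by (simp only: powr_add[symmetric]) simp
    finally have e: "(2 * t powr (- 3/2)) powr a * (sqrt t)\<^sup>2 = 2 powr a * t powr (1 - 3/2 * a)" .
    have "pi + 2 * pi / (3 * a - 2) \<le> 3 * pi" using a by (simp add: field_simps)
    then have "(pi + 2 * pi / (3 * a - 2)) * (2 powr a * t powr (1 - 3/2 * a)) \<le> 3 * pi * (2 powr a * t powr (1 - 3/2 * a))"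
      by (intro mult_right_mono) auto
    then show "(pi + 2 * pi / (3 * a - 2)) * (2 * t powr (- 3/2)) powr a * (sqrt t)\<^sup>2 \<le> 3 * pi * 2 powr a * t powr (1 - 3/2 * a)"
      using e by (simp add: mult.assoc)
  qed
  finally show ?thesis .
qed

lemma nn_integral_heat_kernel_le:
  assumes t: "t > 0"
  shows "(\<integral>\<^sup>+z. ennreal (heat_kernel t z) \<partial>lborel) \<le> ennreal (6 * pi)"
proof -
  have "(\<integral>\<^sup>+z. ennreal (heat_kernel t z powr 1) \<partial>lborel)
      \<le> ennreal ((pi + 2 * pi / (4 * 1 - 2)) * (3 / t) powr 1 * (sqrt t)\<^sup>2)"
    using assms heat_kernel_decay heat_kernel_le heat_kernel_nonneg
    by (intro nn_integral_decay_powr) auto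
  also have "(pi + 2 * pi / (4 * 1 - 2)) * (3 / t) powr 1 * (sqrt t)\<^sup>2 = 6 * pi" using t by simp
  finally show ?thesis using heat_kernel_nonneg[OF t] by simp
qed

lemma heat_kernel_measurable [measurable]:
  "(\<lambda>(s, z). heat_kernel s z) \<in> borel_measurable (borel \<Otimes>\<^sub>M borel)"
  unfolding heat_kernel_def by measurable

lemma grad_heat_kernel_measurable [measurable]:
  "(\<lambda>(s, z). grad_heat_kernel s z) \<in> borel_measurable (borel \<Otimes>\<^sub>M borel)"
  unfolding grad_heat_kernel_def by measurable

lemma ennreal_heat_measure:
  assumes \<mu>: "M_plus \<mu>" and t: "t > 0"
  shows "ennreal (heat_measure t \<mu> x) = (\<integral>\<^sup>+y. ennreal (heat_kernel t (x - y)) \<partial>\<mu>)"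
proof -
  interpret finite_measure \<mu> using \<mu> by (simp add: M_plus_def)
  have [measurable_cong]: "sets \<mu> = sets borel" using \<mu> by (simp add: M_plus_def)
  have "integrable \<mu> (\<lambda>y. heat_kernel t (x - y))"
    using heat_kernel_le[OF t] heat_kernel_nonneg[OF t]
    by (intro integrable_const_bound[where B = "3 / t"]) auto
  then show ?thesis unfolding heat_measure_def
    using heat_kernel_nonneg[OF t] by (intro nn_integral_eq_integral[symmetric]) auto
qed

lemma heat_measure_nonneg: "t > 0 \<Longrightarrow> 0 \<le> heat_measure t \<mu> x"
  unfolding heat_measure_def by (intro Bochner_Integration.integral_nonneg heat_kernel_nonneg)

lemma heat_measure_measurable:
  assumes \<mu>: "M_plus \<mu>"
  shows "heat_measure t \<mu> \<in> borel_measurable borel"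
proof -
  interpret finite_measure \<mu> using \<mu> by (simp add: M_plus_def)
  have [measurable_cong]: "sets \<mu> = sets borel" using \<mu> by (simp add: M_plus_def)
  show ?thesis unfolding heat_measure_def by measurable
qed

lemma heat_measure_le:
  assumes \<mu>: "M_plus \<mu>" and t: "t > 0"
  shows "heat_measure t \<mu> x \<le> 3 * measure \<mu> UNIV / t"
proof -
  interpret finite_measure \<mu> using \<mu> by (simp add: M_plus_def)
  have sp: "space \<mu> = UNIV" using \<mu> sets_eq_imp_space_eq[of \<mu> borel] by (simp add: M_plus_def)
  have "ennreal (heat_measure t \<mu> x) \<le> (\<integral>\<^sup>+y. ennreal (3 / t) \<partial>\<mu>)"
    unfolding ennreal_heat_measure[OF assms] using heat_kernel_le[OF t] by (intro nn_integral_mono ennreal_leI)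
  also have "\<dots> = ennreal (3 / t * measure \<mu> UNIV)"
    using t by (simp add: sp emeasure_eq_measure flip: ennreal_mult')
  finally show ?thesis using t by (subst (asm) ennreal_le_iff) auto
qed

lemma nn_integral_heat_measure_le:
  assumes \<mu>: "M_plus \<mu>" and t: "t > 0"
  shows "(\<integral>\<^sup>+x. ennreal (heat_measure t \<mu> x) \<partial>lborel) \<le> ennreal (6 * pi * measure \<mu> UNIV)"
proof -
  interpret finite_measure \<mu> using \<mu> by (simp add: M_plus_def)
  interpret pair_sigma_finite lborel \<mu> ..
  have [measurable_cong]: "sets \<mu> = sets borel" using \<mu> by (simp add: M_plus_def)
  have sp: "space \<mu> = UNIV" using \<mu> sets_eq_imp_space_eq[of \<mu> borel] by (simp add: M_plus_def)
  have "(\<integral>\<^sup>+x. ennreal (heat_measure t \<mu> x) \<partial>lborel) = (\<integral>\<^sup>+y. (\<integral>\<^sup>+x. ennreal (heat_kernel t (x - y)) \<partial>lborel) \<partial>\<mu>)"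
    unfolding ennreal_heat_measure[OF assms] by (rule Fubini'[symmetric]) measurable
  also have "\<dots> = (\<integral>\<^sup>+y. (\<integral>\<^sup>+x. ennreal (heat_kernel t x) \<partial>lborel) \<partial>\<mu>)"
    by (intro nn_integral_cong nn_integral_lborel_diff') measurable
  also have "\<dots> \<le> (\<integral>\<^sup>+y. ennreal (6 * pi) \<partial>\<mu>)"
    by (intro nn_integral_mono nn_integral_heat_kernel_le t)
  also have "\<dots> = ennreal (6 * pi * measure \<mu> UNIV)"
    by (simp add: sp emeasure_eq_measure ennreal_mult)
  finally show ?thesis .
qed

lemma nn_integral_heat_measure_powr_le:
  assumes \<mu>: "M_plus \<mu>" and t: "t > 0" and q: "q \<ge> 1"
  shows "(\<integral>\<^sup>+x. ennreal (heat_measure t \<mu> x powr q) \<partial>lborel)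
    \<le> ennreal ((3 * measure \<mu> UNIV) powr (q - 1) * (6 * pi * measure \<mu> UNIV) * t powr (1 - q))"
proof -
  let ?m = "measure \<mu> UNIV"
  have "(\<integral>\<^sup>+x. ennreal (heat_measure t \<mu> x powr q) \<partial>lborel)
      \<le> (\<integral>\<^sup>+x. ennreal ((3 * ?m / t) powr (q - 1)) * ennreal (heat_measure t \<mu> x) \<partial>lborel)"
  proof (rule nn_integral_mono)
    fix x
    let ?h = "heat_measure t \<mu> x"
    have "?h powr q = ?h powr (q - 1) * ?h powr 1" by (simp only: powr_add[symmetric]) simp
    also have "\<dots> \<le> (3 * ?m / t) powr (q - 1) * ?h"
      using heat_measure_nonneg[OF t] heat_measure_le[OF \<mu> t] q by (simp add: mult_right_mono powr_mono2)
    finally show "ennreal (?h powr q) \<le> ennreal ((3 * ?m / t) powr (q - 1)) * ennreal ?h"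
      by (simp add: ennreal_leI flip: ennreal_mult')
  qed
  also have "\<dots> = ennreal ((3 * ?m / t) powr (q - 1)) * (\<integral>\<^sup>+x. ennreal (heat_measure t \<mu> x) \<partial>lborel)"
    using heat_measure_measurable[OF \<mu>] by (intro nn_integral_cmult) auto
  also have "\<dots> \<le> ennreal ((3 * ?m / t) powr (q - 1)) * ennreal (6 * pi * ?m)"
    by (intro mult_left_mono nn_integral_heat_measure_le \<mu> t) auto
  also have "\<dots> = ennreal ((3 * ?m) powr (q - 1) * (6 * pi * ?m) * t powr (1 - q))"
  proof -
    have "t powr (1 - q) = 1 / t powr (q - 1)" by (metis minus_diff_eq powr_minus_divide)
    then show ?thesis using t by (simp add: powr_divide flip: ennreal_mult')
  qed
  finally show ?thesis .
qed

section \<open>The Newtonian drift\<close>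

definition near_kernel :: "real \<Rightarrow> R2 \<Rightarrow> real" where
  "near_kernel R z = (if norm z < R then 1 / norm z else 0)"

lemma near_kernel_nonneg: "0 \<le> near_kernel R z"
  by (simp add: near_kernel_def)

lemma near_kernel_measurable [measurable]: "near_kernel R \<in> borel_measurable borel"
  unfolding near_kernel_def by measurable

lemma nn_integral_near_kernel_powr_le:
  assumes "a < 2" "R > 0"
  shows "(\<integral>\<^sup>+z. ennreal (near_kernel R z powr a) \<partial>lborel) \<le> ennreal (2 * pi / (2 - a) * R powr (2 - a))"
proof -
  have "near_kernel R z powr a = norm z powr (- a) * indicator (ball 0 R) z" for z
    by (auto simp: near_kernel_def powr_divide powr_minus_divide split: split_indicator)
  then have "(\<integral>\<^sup>+z. ennreal (near_kernel R z powr a) \<partial>lborel)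
      = (\<integral>\<^sup>+z. ennreal (norm (z::R2) powr (- a)) * indicator (ball 0 R) z \<partial>lborel)"
    by (intro nn_integral_cong) (auto split: split_indicator)
  then show ?thesis using nn_integral_norm_powr_ball[of a R] assms by simp
qed

text \<open>In the diagonal case no maximal function or interpolation is needed: by symmetry it suffices to
  integrate over \<open>f z \<le> f y\<close>, and there the near field is controlled by the value
  \<open>f y\<close> itself.\<close>

lemma HLS_diagonal:
  fixes f :: "R2 \<Rightarrow> real"
  assumes [measurable]: "f \<in> borel_measurable lborel" and f_nn: "\<And>x. 0 \<le> f x" and N: "N > 0"
    and fN: "(\<integral>\<^sup>+x. ennreal (f x powr (4/3)) \<partial>lborel) \<le> ennreal N"
  shows "(\<integral>\<^sup>+y. (\<integral>\<^sup>+z. ennreal (f y * (f z / norm (y - z))) \<partial>lborel) \<partial>lborel) \<le> ennreal (6 * pi * N powr (3/2))"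
proof -
  define S where "S y z = (if f z \<le> f y then ennreal (f y * (f z / norm (y - z))) else 0)" for y z
  have [measurable]: "(\<lambda>(y, z). S y z) \<in> borel_measurable (lborel \<Otimes>\<^sub>M lborel)"
    unfolding S_def by measurable
  have far: "(\<integral>\<^sup>+z. ennreal (f z * (if norm (y - z) < R then 0 else 1 / norm (y - z))) \<partial>lborel)
      \<le> ennreal (N powr (3/4) * (pi * R powr (- 2)) powr (1/4))" if R: "R > 0" for y R
  proof -
    have "(\<integral>\<^sup>+z. ennreal ((if norm (y - z) < R then 0 else 1 / norm (y - z)) powr 4) \<partial>lborel)
        = (\<integral>\<^sup>+z. ennreal ((if norm (z::R2) < R then 0 else 1 / norm z) powr 4) \<partial>lborel)"
      by (rule nn_integral_lborel_diff) measurable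
    also have "\<dots> = (\<integral>\<^sup>+z. ennreal (norm (z::R2) powr (- 4)) * indicator (- ball 0 R) z \<partial>lborel)"
      by (intro nn_integral_cong) (auto simp: power_divide powr_minus_divide split: split_indicator)
    also have "\<dots> \<le> ennreal (2 * pi / (4 - 2) * R powr (2 - 4))"
      using R by (intro nn_integral_norm_powr_outside_ball) auto
    finally have "(\<integral>\<^sup>+z. ennreal ((if norm (y - z) < R then 0 else 1 / norm (y - z)) powr 4) \<partial>lborel)
        \<le> ennreal (pi * R powr (- 2))" by simp
    moreover have "(\<integral>\<^sup>+z. ennreal (f z * (if norm (y - z) < R then 0 else 1 / norm (y - z))) \<partial>lborel)
      \<le> ennreal (N powr (1 / (4/3)) * (pi * R powr (- 2)) powr (1/4))"
      using N f_nn fN calculation by (intro nn_integral_Holder) auto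
    ultimately show ?thesis by simp
  qed
  have near: "(\<integral>\<^sup>+z. ennreal (near_kernel R (y - z)) \<partial>lborel) \<le> ennreal (2 * pi * R)" if "R > 0" for y R
  proof -
    have "(\<integral>\<^sup>+z. ennreal (near_kernel R (y - z)) \<partial>lborel) = (\<integral>\<^sup>+z. ennreal (near_kernel R z powr 1) \<partial>lborel)"
      by (subst nn_integral_lborel_diff) (auto simp: near_kernel_nonneg)
    then show ?thesis using nn_integral_near_kernel_powr_le[of 1 R] that by simp
  qed
  have inner: "(\<integral>\<^sup>+z. S y z \<partial>lborel) \<le> ennreal (3 * pi * N powr (1/2)) * ennreal (f y powr (4/3))" for y
  proof (cases "f y = 0")
    case True
    then have "S y z = 0" for z by (simp add: S_def)
    then show ?thesis by simp
  next
    case False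
    define b where "b = f y"
    have b: "b > 0" using False f_nn[of y] by (simp add: b_def)
    \<comment> \<open>This radius balances the near and the far contribution.\<close>
    define R where "R = N powr (1/2) * b powr (- 2/3)"
    have R: "R > 0" using N b by (simp add: R_def)
    have "(\<integral>\<^sup>+z. S y z \<partial>lborel) \<le> (\<integral>\<^sup>+z. ennreal (b * b) * ennreal (near_kernel R (y - z))
        + ennreal b * ennreal (f z * (if norm (y - z) < R then 0 else 1 / norm (y - z))) \<partial>lborel)"
    proof (rule nn_integral_mono)
      fix z
      show "S y z \<le> ennreal (b * b) * ennreal (near_kernel R (y - z))
        + ennreal b * ennreal (f z * (if norm (y - z) < R then 0 else 1 / norm (y - z)))"
      proof (cases "norm (y - z) < R")
        case True
        then show ?thesis using b f_nn[of z]
          by (auto simp: S_def near_kernel_def b_def[symmetric] simp flip: ennreal_mult' intro!: ennreal_leI divide_right_mono)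
      next
        case False
        then show ?thesis using b f_nn[of z]
          by (auto simp: S_def near_kernel_def b_def[symmetric] simp flip: ennreal_mult')
      qed
    qed
    also have "\<dots> = ennreal (b * b) * (\<integral>\<^sup>+z. ennreal (near_kernel R (y - z)) \<partial>lborel)
        + ennreal b * (\<integral>\<^sup>+z. ennreal (f z * (if norm (y - z) < R then 0 else 1 / norm (y - z))) \<partial>lborel)"
      by (subst nn_integral_add) (auto simp: nn_integral_cmult)
    also have "\<dots> \<le> ennreal (b * b) * ennreal (2 * pi * R) + ennreal b * ennreal (N powr (3/4) * (pi * R powr (- 2)) powr (1/4))"
      by (intro add_mono mult_left_mono near far R) auto
    also have "\<dots> = ennreal (b * b * (2 * pi * R) + b * (N powr (3/4) * (pi * R powr (- 2)) powr (1/4)))"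
      using b R by (simp flip: ennreal_mult' ennreal_plus)
    also have "\<dots> \<le> ennreal (3 * pi * N powr (1/2) * b powr (4/3))"
    proof (rule ennreal_leI)
      have e1: "b * b * R = N powr (1/2) * b powr (4/3)"
      proof -
        have "b * b * R = N powr (1/2) * (b powr 1 * b powr 1 * b powr (- 2/3))"
          using b by (simp add: R_def)
        also have "b powr 1 * b powr 1 * b powr (- 2/3) = b powr (4/3)"
          by (simp only: powr_add[symmetric]) simp
        finally show ?thesis .
      qed
      have e2: "b * (N powr (3/4) * R powr (- 1/2)) = N powr (1/2) * b powr (4/3)"
      proof -
        have "R powr (- 1/2) = N powr (- 1/4) * b powr (1/3)"
          using N b by (simp add: R_def powr_mult powr_powr)
        then have "b * (N powr (3/4) * R powr (- 1/2)) = (N powr (3/4) * N powr (- 1/4)) * (b powr 1 * b powr (1/3))"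
          using b by simp
        also have "\<dots> = N powr (1/2) * b powr (4/3)"
          by (simp only: powr_add[symmetric]) simp
        finally show ?thesis .
      qed
      have "(pi * R powr (- 2)) powr (1/4) = pi powr (1/4) * R powr (- 1/2)"
        using R by (simp add: powr_mult powr_powr)
      moreover have "pi powr (1/4) \<le> pi powr 1" using pi_gt3 by (intro powr_mono) auto
      ultimately have "(pi * R powr (- 2)) powr (1/4) \<le> pi * R powr (- 1/2)"
        by (simp add: mult_right_mono)
      then have "b * (N powr (3/4) * (pi * R powr (- 2)) powr (1/4)) \<le> b * (N powr (3/4) * (pi * R powr (- 1/2)))"
        using b by (intro mult_left_mono) auto
      also have "\<dots> = pi * (N powr (1/2) * b powr (4/3))" unfolding e2[symmetric] by simp
      finally have "b * (N powr (3/4) * (pi * R powr (- 2)) powr (1/4)) \<le> pi * (N powr (1/2) * b powr (4/3))" .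
      moreover have "b * b * (2 * pi * R) = 2 * (pi * (N powr (1/2) * b powr (4/3)))"
        unfolding e1[symmetric] by simp
      moreover have "3 * pi * N powr (1/2) * b powr (4/3) = 3 * (pi * (N powr (1/2) * b powr (4/3)))" by simp
      ultimately show "b * b * (2 * pi * R) + b * (N powr (3/4) * (pi * R powr (- 2)) powr (1/4))
          \<le> 3 * pi * N powr (1/2) * b powr (4/3)"
        by linarith
    qed
    finally show ?thesis by (simp add: b_def ennreal_mult)
  qed
  have half: "(\<integral>\<^sup>+y. (\<integral>\<^sup>+z. S y z \<partial>lborel) \<partial>lborel) \<le> ennreal (3 * pi * N powr (3/2))"
  proof -
    have "(\<integral>\<^sup>+y. (\<integral>\<^sup>+z. S y z \<partial>lborel) \<partial>lborel) \<le> (\<integral>\<^sup>+y. ennreal (3 * pi * N powr (1/2)) * ennreal (f y powr (4/3)) \<partial>lborel)"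
      by (intro nn_integral_mono inner)
    also have "\<dots> = ennreal (3 * pi * N powr (1/2)) * (\<integral>\<^sup>+y. ennreal (f y powr (4/3)) \<partial>lborel)"
      by (rule nn_integral_cmult) measurable
    also have "\<dots> \<le> ennreal (3 * pi * N powr (1/2)) * ennreal N"
      by (intro mult_left_mono fN) auto
    also have "\<dots> = ennreal (3 * pi * (N powr (1/2) * N powr 1))"
      using N by (simp flip: ennreal_mult')
    also have "N powr (1/2) * N powr 1 = N powr (3/2)"
      by (simp only: powr_add[symmetric]) simp
    finally show ?thesis .
  qed
  have "(\<integral>\<^sup>+y. (\<integral>\<^sup>+z. ennreal (f y * (f z / norm (y - z))) \<partial>lborel) \<partial>lborel)
      \<le> (\<integral>\<^sup>+y. (\<integral>\<^sup>+z. S y z + S z y \<partial>lborel) \<partial>lborel)"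
    by (intro nn_integral_mono) (auto simp: S_def norm_minus_commute mult.commute)
  also have "\<dots> = (\<integral>\<^sup>+y. (\<integral>\<^sup>+z. S y z \<partial>lborel) \<partial>lborel) + (\<integral>\<^sup>+y. (\<integral>\<^sup>+z. S z y \<partial>lborel) \<partial>lborel)"
    by (simp add: nn_integral_add)
  also have "(\<integral>\<^sup>+y. (\<integral>\<^sup>+z. S z y \<partial>lborel) \<partial>lborel) = (\<integral>\<^sup>+z. (\<integral>\<^sup>+y. S z y \<partial>lborel) \<partial>lborel)"
    by (rule lborel_pair.Fubini') measurable
  also have "(\<integral>\<^sup>+y. (\<integral>\<^sup>+z. S y z \<partial>lborel) \<partial>lborel) + \<dots> \<le> ennreal (3 * pi * N powr (3/2)) + ennreal (3 * pi * N powr (3/2))"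
    by (intro add_mono half)
  also have "\<dots> = ennreal (6 * pi * N powr (3/2))"
    by (simp flip: ennreal_plus)
  finally show ?thesis .
qed

lemma norm_grad_c_le:
  "ennreal (norm (grad_c v y)) \<le> (\<integral>\<^sup>+z. ennreal (\<bar>v z\<bar> / norm (y - z)) \<partial>lborel)"
proof -
  let ?g = "\<lambda>z. (v z / (norm (y - z))\<^sup>2) *\<^sub>R (y - z)"
  have "norm (?g z) = \<bar>v z\<bar> / norm (y - z)" for z
    by (cases "y = z") (auto simp: power2_eq_square)
  then have "ennreal (norm (integral\<^sup>L lborel ?g)) \<le> (\<integral>\<^sup>+z. ennreal (\<bar>v z\<bar> / norm (y - z)) \<partial>lborel)"
    using integral_norm_bound_ennreal[of lborel ?g]
    by (cases "integrable lborel ?g") (auto simp: not_integrable_integral_eq)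
  moreover have "norm (grad_c v y) \<le> norm (integral\<^sup>L lborel ?g)"
  proof -
    have "1 / (2 * pi) \<le> 1" using pi_gt3 by simp
    then have "1 / (2 * pi) * norm (integral\<^sup>L lborel ?g) \<le> 1 * norm (integral\<^sup>L lborel ?g)"
      by (intro mult_right_mono) auto
    then show ?thesis by (simp add: grad_c_def)
  qed
  ultimately show ?thesis by (meson ennreal_leI order.trans)
qed

lemma norm_grad_c_split:
  assumes [measurable]: "v \<in> borel_measurable lborel" and R: "R > 0" and m: "m \<ge> 0"
    and vm: "(\<integral>\<^sup>+z. ennreal \<bar>v z\<bar> \<partial>lborel) \<le> ennreal m"
  shows "ennreal (norm (grad_c v y)) \<le> ennreal (m / R) + (\<integral>\<^sup>+z. ennreal (near_kernel R (y - z) * \<bar>v z\<bar>) \<partial>lborel)"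
proof -
  have "ennreal (norm (grad_c v y)) \<le> (\<integral>\<^sup>+z. ennreal (\<bar>v z\<bar> / norm (y - z)) \<partial>lborel)"
    by (rule norm_grad_c_le)
  also have "\<dots> \<le> (\<integral>\<^sup>+z. ennreal (1 / R) * ennreal \<bar>v z\<bar> + ennreal (near_kernel R (y - z) * \<bar>v z\<bar>) \<partial>lborel)"
  proof (rule nn_integral_mono)
    fix z
    have "\<bar>v z\<bar> / norm (y - z) \<le> 1 / R * \<bar>v z\<bar> + near_kernel R (y - z) * \<bar>v z\<bar>"
    proof (cases "norm (y - z) < R")
      case True
      then show ?thesis using R by (simp add: near_kernel_def)
    next
      case False
      then have "\<bar>v z\<bar> / norm (y - z) \<le> \<bar>v z\<bar> / R" using R by (intro divide_left_mono mult_pos_pos) auto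
      then show ?thesis using False by (simp add: near_kernel_def)
    qed
    then show "ennreal (\<bar>v z\<bar> / norm (y - z)) \<le> ennreal (1 / R) * ennreal \<bar>v z\<bar> + ennreal (near_kernel R (y - z) * \<bar>v z\<bar>)"
      using R near_kernel_nonneg[of R "y - z"] by (simp flip: ennreal_mult' ennreal_plus)
  qed
  also have "\<dots> = ennreal (1 / R) * (\<integral>\<^sup>+z. ennreal \<bar>v z\<bar> \<partial>lborel) + (\<integral>\<^sup>+z. ennreal (near_kernel R (y - z) * \<bar>v z\<bar>) \<partial>lborel)"
    by (subst nn_integral_add) (auto simp: nn_integral_cmult)
  also have "\<dots> \<le> ennreal (1 / R) * ennreal m + (\<integral>\<^sup>+z. ennreal (near_kernel R (y - z) * \<bar>v z\<bar>) \<partial>lborel)"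
    by (intro add_right_mono mult_left_mono vm) auto
  also have "ennreal (1 / R) * ennreal m = ennreal (m / R)" using R m by (simp flip: ennreal_mult')
  finally show ?thesis .
qed

lemma grad_c_measurable:
  assumes [measurable]: "v \<in> borel_measurable lborel"
  shows "grad_c v \<in> borel_measurable lborel"
  unfolding grad_c_def by measurable

lemma nn_integral_grad_c_excess_powr_le:
  assumes [measurable]: "v \<in> borel_measurable lborel" and s: "s > 0" and C: "C\<^sub>1 > 0" "C\<^sub>2 > 0"
    and v1: "(\<integral>\<^sup>+z. ennreal \<bar>v z\<bar> \<partial>lborel) \<le> ennreal C\<^sub>1"
    and v2: "(\<integral>\<^sup>+z. ennreal (\<bar>v z\<bar> powr (7/4)) \<partial>lborel) \<le> ennreal (C\<^sub>2 * s powr (- 3/4))"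
  shows "(\<integral>\<^sup>+y. ennreal ((max 0 (norm (grad_c v y) - C\<^sub>1 / sqrt s)) powr (7/2)) \<partial>lborel)
    \<le> ennreal ((2 * ((10/3 * pi) powr (5/7) * C\<^sub>2 powr (4/7))) powr (7/2) * s powr (- 3/4))"
proof -
  define \<kappa> where "\<kappa> = (10/3 * pi) powr (5/7) * C\<^sub>2 powr (4/7)"
  have \<kappa>: "\<kappa> > 0" using C by (simp add: \<kappa>_def)
  note [measurable] = grad_c_measurable[OF assms(1)]
  have "(\<integral>\<^sup>+y. ennreal ((max 0 (norm (grad_c v y) - C\<^sub>1 / sqrt s)) powr (7/2)) \<partial>lborel)
      \<le> ennreal ((2 * (\<kappa> * s powr (- 3/14))) powr (7/2))"
  proof (rule Young_Minkowski[where S = "count_space {()}" and a = "7/5" and r = "7/4" and q = "7/2"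
        and G = "\<lambda>_. near_kernel (sqrt s)" and f = "\<lambda>_ z. \<bar>v z\<bar>"
        and A = "\<lambda>_. 10/3 * pi * s powr (3/10)" and B = "\<lambda>_. C\<^sub>2 * s powr (- 3/4)"])
    show "sigma_finite_measure (count_space {()})" by (rule sigma_finite_measure_count_space_finite) simp
    show "AE y in lborel. ennreal (max 0 (norm (grad_c v y) - C\<^sub>1 / sqrt s))
        \<le> (\<integral>\<^sup>+ _. (\<integral>\<^sup>+z. ennreal (near_kernel (sqrt s) (y - z) * \<bar>v z\<bar>) \<partial>lborel) \<partial>count_space {()})"
    proof (rule AE_I2)
      fix y
      have "ennreal (max 0 (norm (grad_c v y) - C\<^sub>1 / sqrt s))
          \<le> (\<integral>\<^sup>+z. ennreal (near_kernel (sqrt s) (y - z) * \<bar>v z\<bar>) \<partial>lborel)"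
        using C s by (intro ennreal_max_diff_le norm_grad_c_split v1) auto
      then show "ennreal (max 0 (norm (grad_c v y) - C\<^sub>1 / sqrt s))
          \<le> (\<integral>\<^sup>+ _. (\<integral>\<^sup>+z. ennreal (near_kernel (sqrt s) (y - z) * \<bar>v z\<bar>) \<partial>lborel) \<partial>count_space {()})"
        by (simp add: nn_integral_count_space_finite)
    qed
    show "(\<integral>\<^sup>+z. ennreal (near_kernel (sqrt s) z powr (7/5)) \<partial>lborel) \<le> ennreal (10/3 * pi * s powr (3/10))"
    proof -
      have "sqrt s powr (3/5) = s powr (3/10)" using s by (simp add: powr_half_sqrt[symmetric] powr_powr)
      then show ?thesis using nn_integral_near_kernel_powr_le[of "7/5" "sqrt s"] s by simp
    qed
    have "(10/3 * pi * s powr (3/10)) powr (1/(7/5)) * (C\<^sub>2 * s powr (- 3/4)) powr (1/(7/4))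
        = \<kappa> * (s powr (3/14) * s powr (- 3/7))"
      using s C by (subst (1 2) powr_mult) (auto simp: powr_powr \<kappa>_def)
    also have "s powr (3/14) * s powr (- 3/7) = s powr (- 3/14)"
      by (simp only: powr_add[symmetric]) simp
    finally show "(\<integral>\<^sup>+_. ennreal ((10/3 * pi * s powr (3/10)) powr (1/(7/5)) * (C\<^sub>2 * s powr (- 3/4)) powr (1/(7/4))) \<partial>count_space {()})
        \<le> ennreal (\<kappa> * s powr (- 3/14))"
      by (simp add: nn_integral_count_space_finite)
  qed (use s C \<kappa> v2 in \<open>auto simp: near_kernel_nonneg\<close>)
  also have "(2 * (\<kappa> * s powr (- 3/14))) powr (7/2) = (2 * \<kappa>) powr (7/2) * s powr (- 3/4)"
    using \<kappa> by (simp add: powr_mult powr_powr mult.assoc)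
  finally show ?thesis by (simp add: \<kappa>_def)
qed

lemma flux_powr_pointwise:
  fixes a g m s :: real
  assumes "0 \<le> a" "0 \<le> g" "0 \<le> m" "0 < s"
  defines "w \<equiv> max 0 (g - m / sqrt s)"
  shows "(a * g) powr (7/6) \<le> 2 powr (7/6) * (2 powr (7/6) * (a powr (7/4) + w powr (7/2))
    + m powr (7/6) * (s powr (- 3/4) * a + a powr (7/4)))"
proof -
  have w: "w \<ge> 0" by (simp add: w_def)
  have "a * g \<le> a * (w + m / sqrt s)" using assms by (intro mult_left_mono) (auto simp: w_def)
  then have "(a * g) powr (7/6) \<le> (a * w + a * (m / sqrt s)) powr (7/6)"
    using assms by (intro powr_mono2) (auto simp: distrib_left)
  also have "\<dots> \<le> 2 powr (7/6) * ((a * w) powr (7/6) + (a * (m / sqrt s)) powr (7/6))"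
    using assms w by (intro powr_add_le) auto
  finally have 1: "(a * g) powr (7/6) \<le> \<dots>" .
  have "a * w \<le> a powr (3/2) / (3/2) + w powr 3 / 3"
    using assms w by (intro Youngs_inequality) auto
  also have "\<dots> \<le> a powr (3/2) + w powr 3" by (intro add_mono) (simp_all add: divide_le_eq)
  finally have "(a * w) powr (7/6) \<le> (a powr (3/2) + w powr 3) powr (7/6)"
    using assms w by (intro powr_mono2) auto
  also have "\<dots> \<le> 2 powr (7/6) * ((a powr (3/2)) powr (7/6) + (w powr 3) powr (7/6))"
    by (intro powr_add_le) auto
  also have "\<dots> = 2 powr (7/6) * (a powr (7/4) + w powr (7/2))"
    by (simp only: powr_powr) simp
  finally have 2: "(a * w) powr (7/6) \<le> \<dots>" .
  have "(s * a) powr (7/6) \<le> s * a + (s * a) powr (7/4)"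
  proof (cases "s * a \<le> 1")
    case True
    then have "(s * a) powr (7/6) \<le> (s * a) powr 1" using assms by (intro powr_mono') auto
    also have "\<dots> = s * a" using assms by simp
    finally show ?thesis by (simp add: add_increasing2)
  next
    case False
    then have "(s * a) powr (7/6) \<le> (s * a) powr (7/4)" by (intro powr_mono) auto
    then show ?thesis using assms by (simp add: add_increasing)
  qed
  then have "s powr (7/6) * a powr (7/6) \<le> s * a + s powr (7/4) * a powr (7/4)"
    using assms by (simp add: powr_mult)
  then have le: "s powr (- 7/4) * (s powr (7/6) * a powr (7/6)) \<le> s powr (- 7/4) * (s * a + s powr (7/4) * a powr (7/4))"
    by (intro mult_left_mono) auto
  have "s powr (- 7/12) * a powr (7/6) = s powr (- 7/4) * (s powr (7/6) * a powr (7/6))"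
    by (simp only: mult.assoc[symmetric] powr_add[symmetric]) simp
  also note le
  also have "s powr (- 7/4) * (s * a + s powr (7/4) * a powr (7/4))
      = (s powr (- 7/4) * s powr 1) * a + (s powr (- 7/4) * s powr (7/4)) * a powr (7/4)"
    using assms by (simp add: algebra_simps)
  also have "\<dots> = s powr (- 3/4) * a + a powr (7/4)"
    using assms by (simp only: powr_add[symmetric]) simp
  finally have "s powr (- 7/12) * a powr (7/6) \<le> s powr (- 3/4) * a + a powr (7/4)" .
  then have "m powr (7/6) * (s powr (- 7/12) * a powr (7/6)) \<le> m powr (7/6) * (s powr (- 3/4) * a + a powr (7/4))"
    by (intro mult_left_mono) auto
  moreover have "(a * (m / sqrt s)) powr (7/6) = m powr (7/6) * (s powr (- 7/12) * a powr (7/6))"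
    using assms by (simp add: powr_mult powr_divide powr_half_sqrt[symmetric] powr_powr powr_minus_divide)
  ultimately have 3: "(a * (m / sqrt s)) powr (7/6) \<le> m powr (7/6) * (s powr (- 3/4) * a + a powr (7/4))" by simp
  have "2 powr (7/6) * ((a * w) powr (7/6) + (a * (m / sqrt s)) powr (7/6))
      \<le> 2 powr (7/6) * (2 powr (7/6) * (a powr (7/4) + w powr (7/2)) + m powr (7/6) * (s powr (- 3/4) * a + a powr (7/4)))"
    using 2 3 by (intro mult_left_mono add_mono) auto
  with 1 show ?thesis by (rule order.trans)
qed

lemma norm_grad_c_Linf_le:
  assumes [measurable]: "v \<in> borel_measurable lborel" and s: "s > 0" and C: "C\<^sub>1 > 0" "C\<^sub>2 > 0"
    and v1: "(\<integral>\<^sup>+z. ennreal \<bar>v z\<bar> \<partial>lborel) \<le> ennreal C\<^sub>1"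
    and v2: "(\<integral>\<^sup>+z. ennreal (\<bar>v z\<bar> powr (5/2)) \<partial>lborel) \<le> ennreal (C\<^sub>2 * s powr (- 3/2))"
  shows "norm (grad_c v y) \<le> (C\<^sub>1 + (6 * pi) powr (3/5) * C\<^sub>2 powr (2/5)) * s powr (- 1/2)"
proof -
  have near: "(\<integral>\<^sup>+z. ennreal (near_kernel (sqrt s) (y - z) powr (5/3)) \<partial>lborel) \<le> ennreal (6 * pi * s powr (1/6))"
  proof -
    have "(\<integral>\<^sup>+z. ennreal (near_kernel (sqrt s) (y - z) powr (5/3)) \<partial>lborel) = (\<integral>\<^sup>+z. ennreal (near_kernel (sqrt s) z powr (5/3)) \<partial>lborel)"
      by (rule nn_integral_lborel_diff) measurable
    moreover have "sqrt s powr (1/3) = s powr (1/6)" using s by (simp add: powr_half_sqrt[symmetric] powr_powr)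
    ultimately show ?thesis using nn_integral_near_kernel_powr_le[of "5/3" "sqrt s"] s by simp
  qed
  have "ennreal (norm (grad_c v y)) \<le> ennreal (C\<^sub>1 / sqrt s) + (\<integral>\<^sup>+z. ennreal (near_kernel (sqrt s) (y - z) * \<bar>v z\<bar>) \<partial>lborel)"
    using C s by (intro norm_grad_c_split v1) auto
  also have "\<dots> \<le> ennreal (C\<^sub>1 / sqrt s) + ennreal ((6 * pi * s powr (1/6)) powr (1/(5/3)) * (C\<^sub>2 * s powr (- 3/2)) powr (1/(5/2)))"
    using C s near v2 by (intro add_left_mono nn_integral_Holder) (auto simp: near_kernel_nonneg)
  also have "(6 * pi * s powr (1/6)) powr (1/(5/3)) * (C\<^sub>2 * s powr (- 3/2)) powr (1/(5/2))
      = (6 * pi) powr (3/5) * C\<^sub>2 powr (2/5) * (s powr (1/10) * s powr (- 3/5))"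
    using C by (subst (1 2) powr_mult) (auto simp: powr_powr)
  also have "s powr (1/10) * s powr (- 3/5) = s powr (- 1/2)"
    by (simp only: powr_add[symmetric]) simp
  also have "C\<^sub>1 / sqrt s = C\<^sub>1 * s powr (- 1/2)" using s by (simp add: powr_minus_divide powr_half_sqrt)
  also have "ennreal (C\<^sub>1 * s powr (- 1/2)) + ennreal ((6 * pi) powr (3/5) * C\<^sub>2 powr (2/5) * s powr (- 1/2))
      = ennreal ((C\<^sub>1 + (6 * pi) powr (3/5) * C\<^sub>2 powr (2/5)) * s powr (- 1/2))"
    using C by (simp add: distrib_right flip: ennreal_plus)
  finally show ?thesis using C by (subst (asm) ennreal_le_iff) auto
qed

section \<open>Bootstrap for mild solutions\<close>

lemma measurable_restrict_space_pair_ident: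
  "(\<lambda>w. w) \<in> measurable (restrict_space M A \<Otimes>\<^sub>M N) (M \<Otimes>\<^sub>M N)"
proof -
  have "(\<lambda>w. (fst w, snd w)) \<in> measurable (restrict_space M A \<Otimes>\<^sub>M N) (M \<Otimes>\<^sub>M N)"
    by (intro measurable_Pair measurable_compose[OF measurable_fst] measurable_restrict_space1) auto
  then show ?thesis by simp
qed

definition flux :: "(real \<Rightarrow> R2 \<Rightarrow> real) \<Rightarrow> real \<Rightarrow> R2 \<Rightarrow> real" where
  "flux u s y = norm (u s y *\<^sub>R grad_c (u s) y)"

lemma flux_nonneg: "0 \<le> flux u s y" by (simp add: flux_def)

lemma AE_lborel_ex:
  fixes P :: "'a::euclidean_space \<Rightarrow> bool"
  assumes "AE x in lborel. P x" shows "\<exists>x. P x"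
proof -
  have "ae_filter (lborel :: 'a measure) \<noteq> bot"
    by (simp add: ae_filter_eq_bot_iff)
  then show ?thesis using assms by (rule eventually_happens')
qed

text \<open>Joint measurability in \<open>(s, y)\<close> is not part of the definition of a mild solution. It follows
  from that of the Duhamel integrand: after division by the scalar factor the integrand is
  \<open>(x - y) \<bullet> (u \<nabla>c)\<close>, and the difference of two of these with base points
  \<open>x + e\<close> and \<open>x\<close> is the component of \<open>u \<nabla>c\<close> along \<open>e\<close>.\<close>

lemma flux_measurable:
  assumes D: "AE x in lborel. (duhamel_integrand u t x) \<in> borel_measurable (lborel \<Otimes>\<^sub>M lborel)"
  shows "(\<lambda>(s, y). flux u s y) \<in> borel_measurable (restrict_space lborel {0<..<t} \<Otimes>\<^sub>M lborel)"
proof -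
  let ?\<Omega> = "restrict_space lborel {0<..<t} \<Otimes>\<^sub>M (lborel :: R2 measure)"
  note id = measurable_restrict_space_pair_ident[where M = "lborel :: real measure" and N = "lborel :: R2 measure" and A = "{0<..<t}"]
  define W where "W w = u (fst w) (snd w) *\<^sub>R grad_c (u (fst w)) (snd w)" for w
  have m: "(\<lambda>w. (x - snd w) \<bullet> W w) \<in> borel_measurable ?\<Omega>"
    if "duhamel_integrand u t x \<in> borel_measurable (lborel \<Otimes>\<^sub>M lborel)" for x
  proof -
    have [measurable]: "duhamel_integrand u t x \<in> borel_measurable ?\<Omega>"
      using measurable_compose[OF id that] by simp
    have c: "(\<lambda>w. - heat_kernel (t - fst w) (x - snd w) / (2 * (t - fst w))) \<in> borel_measurable ?\<Omega>"
      by (rule measurable_compose[OF id]) measurable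
    have "(\<lambda>w. duhamel_integrand u t x w / (- heat_kernel (t - fst w) (x - snd w) / (2 * (t - fst w)))) \<in> borel_measurable ?\<Omega>"
      using c by measurable
    also have "?this \<longleftrightarrow> ?thesis"
    proof (rule measurable_cong)
      fix w assume "w \<in> space ?\<Omega>"
      then have w: "fst w \<in> {0<..<t}" by (auto simp: space_pair_measure)
      then have "heat_kernel (t - fst w) (x - snd w) > 0" by (simp add: heat_kernel_def)
      with w show "duhamel_integrand u t x w / (- heat_kernel (t - fst w) (x - snd w) / (2 * (t - fst w))) = (x - snd w) \<bullet> W w"
        by (cases w) (simp add: duhamel_integrand_def grad_heat_kernel_def W_def)
    qed
    finally show ?thesis .
  qed
  have "W \<in> borel_measurable ?\<Omega>"
  proof (subst borel_measurable_euclidean_space, intro ballI)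
    fix e :: R2
    have "AE x in distr lborel borel ((+) e). duhamel_integrand u t x \<in> borel_measurable (lborel \<Otimes>\<^sub>M lborel)"
      using D unfolding lborel_distr_plus .
    then have "AE x in lborel. duhamel_integrand u t (e + x) \<in> borel_measurable (lborel \<Otimes>\<^sub>M lborel)"
      by (rule AE_distrD[rotated]) simp
    with D have "AE x in lborel. duhamel_integrand u t x \<in> borel_measurable (lborel \<Otimes>\<^sub>M lborel)
        \<and> duhamel_integrand u t (e + x) \<in> borel_measurable (lborel \<Otimes>\<^sub>M lborel)" by eventually_elim auto
    then obtain x where "duhamel_integrand u t x \<in> borel_measurable (lborel \<Otimes>\<^sub>M lborel)"
        "duhamel_integrand u t (e + x) \<in> borel_measurable (lborel \<Otimes>\<^sub>M lborel)" using AE_lborel_ex by blast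
    then have "(\<lambda>w. (e + x - snd w) \<bullet> W w - (x - snd w) \<bullet> W w) \<in> borel_measurable ?\<Omega>"
      by (intro borel_measurable_diff m)
    moreover have "(e + x - snd w) \<bullet> W w - (x - snd w) \<bullet> W w = W w \<bullet> e" for w
      by (simp add: inner_diff_left inner_add_left inner_commute[of e])
    ultimately show "(\<lambda>w. W w \<bullet> e) \<in> borel_measurable ?\<Omega>" by simp
  qed
  then have "(\<lambda>w. norm (W w)) \<in> borel_measurable ?\<Omega>" by measurable
  then show ?thesis by (simp add: W_def flux_def case_prod_beta')
qed

lemma duhamel_bound:
  assumes D: "integrable (lborel \<Otimes>\<^sub>M lborel) (duhamel_integrand u t x)"
    and u: "v = h - (\<integral>sy. duhamel_integrand u t x sy \<partial>(lborel \<Otimes>\<^sub>M lborel))" and "0 \<le> h"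
  shows "ennreal \<bar>v\<bar> \<le> ennreal h + (\<integral>\<^sup>+s. (\<integral>\<^sup>+y. ennreal (norm (grad_heat_kernel (t - s) (x - y)) * flux u s y) \<partial>lborel)
      \<partial>restrict_space lborel {0<..<t})"
proof -
  let ?I = "\<integral>sy. duhamel_integrand u t x sy \<partial>(lborel \<Otimes>\<^sub>M lborel)"
  note [measurable] = borel_measurable_integrable[OF D]
  have "ennreal \<bar>?I\<bar> \<le> (\<integral>\<^sup>+w. ennreal \<bar>duhamel_integrand u t x w\<bar> \<partial>(lborel \<Otimes>\<^sub>M lborel))"
    using integral_norm_bound_ennreal[OF D] by simp
  also have "\<dots> = (\<integral>\<^sup>+s. (\<integral>\<^sup>+y. ennreal \<bar>duhamel_integrand u t x (s, y)\<bar> \<partial>lborel) \<partial>lborel)"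
    by (subst lborel.nn_integral_fst[symmetric]) auto
  also have "\<dots> \<le> (\<integral>\<^sup>+s. (\<integral>\<^sup>+y. ennreal (norm (grad_heat_kernel (t - s) (x - y)) * flux u s y) \<partial>lborel) * indicator {0<..<t} s \<partial>lborel)"
  proof (rule nn_integral_mono)
    fix s
    show "(\<integral>\<^sup>+y. ennreal \<bar>duhamel_integrand u t x (s, y)\<bar> \<partial>lborel)
        \<le> (\<integral>\<^sup>+y. ennreal (norm (grad_heat_kernel (t - s) (x - y)) * flux u s y) \<partial>lborel) * indicator {0<..<t} s"
    proof (cases "s \<in> {0<..<t}")
      case True
      have "\<bar>duhamel_integrand u t x (s, y)\<bar> \<le> norm (grad_heat_kernel (t - s) (x - y)) * flux u s y" for y
        using Cauchy_Schwarz_ineq2[of "grad_heat_kernel (t - s) (x - y)" "u s y *\<^sub>R grad_c (u s) y"] True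
        by (simp add: duhamel_integrand_def flux_def)
      then show ?thesis using True by (auto intro!: nn_integral_mono ennreal_leI)
    qed (simp add: duhamel_integrand_def)
  qed
  also have "\<dots> = (\<integral>\<^sup>+s. (\<integral>\<^sup>+y. ennreal (norm (grad_heat_kernel (t - s) (x - y)) * flux u s y) \<partial>lborel)
      \<partial>restrict_space lborel {0<..<t})"
    by (subst nn_integral_restrict_space) auto
  finally have "ennreal \<bar>?I\<bar> \<le> \<dots>" .
  moreover have "ennreal \<bar>v\<bar> \<le> ennreal h + ennreal \<bar>?I\<bar>"
  proof -
    have "\<bar>v\<bar> \<le> h + \<bar>?I\<bar>" using u \<open>0 \<le> h\<close> by linarith
    then show ?thesis using \<open>0 \<le> h\<close> by (metis abs_ge_zero ennreal_leI ennreal_plus)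
  qed
  ultimately show ?thesis by (meson add_left_mono order.trans)
qed

lemma mild_duhamel_bound:
  assumes sol: "mild_solution T \<mu> u" and t: "t \<in> {0<..<T}"
  shows "AE x in lborel. ennreal \<bar>u t x\<bar> \<le> ennreal (heat_measure t \<mu> x)
    + (\<integral>\<^sup>+s. (\<integral>\<^sup>+y. ennreal (norm (grad_heat_kernel (t - s) (x - y)) * flux u s y) \<partial>lborel)
      \<partial>restrict_space lborel {0<..<t})"
proof -
  have "AE x in lborel. integrable (lborel \<Otimes>\<^sub>M lborel) (duhamel_integrand u t x) \<and>
        u t x = heat_measure t \<mu> x - (\<integral>sy. duhamel_integrand u t x sy \<partial>(lborel \<Otimes>\<^sub>M lborel))"
    using sol t unfolding mild_solution_def by blast
  then show ?thesis
    by eventually_elim (use t heat_measure_nonneg duhamel_bound in auto)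
qed

lemma mild_flux_measurable:
  assumes sol: "mild_solution T \<mu> u" and t: "t \<in> {0<..<T}"
  shows "(\<lambda>(s, y). flux u s y) \<in> borel_measurable (restrict_space lborel {0<..<t} \<Otimes>\<^sub>M lborel)"
proof (rule flux_measurable)
  have "AE x in lborel. integrable (lborel \<Otimes>\<^sub>M lborel) (duhamel_integrand u t x) \<and>
        u t x = heat_measure t \<mu> x - (\<integral>sy. duhamel_integrand u t x sy \<partial>(lborel \<Otimes>\<^sub>M lborel))"
    using sol t unfolding mild_solution_def by blast
  then show "AE x in lborel. duhamel_integrand u t x \<in> borel_measurable (lborel \<Otimes>\<^sub>M lborel)"
    by eventually_elim auto
qed

lemma mild_smoothing:
  assumes sol: "mild_solution T \<mu> u"
    and rq: "1 \<le> r" "r < 2" "1 \<le> q" "1/q \<le> 1/r" "1/r - 1/2 < 1/q" and B: "B > 0"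
    and fB: "\<And>s. s \<in> {0<..<T} \<Longrightarrow> (\<integral>\<^sup>+y. ennreal (flux u s y powr r) \<partial>lborel) \<le> ennreal (B * s powr (1 - 3/2 * r))"
  shows "\<exists>C>0. \<forall>t\<in>{0<..<T}. (\<integral>\<^sup>+x. ennreal (\<bar>u t x\<bar> powr q) \<partial>lborel) \<le> ennreal (C * t powr (1 - q))"
proof -
  define a where "a = 1 / (1 + 1/q - 1/r)"
  have ia: "1/a = 1 + 1/q - 1/r" by (simp add: a_def)
  have r1: "1/2 < 1/r" "1/r \<le> 1" using rq by (auto simp: field_simps)
  have a1: "1/2 < 1/a" "1/a \<le> 1" unfolding ia using rq r1 by linarith+
  have a0: "a > 0"
  proof (rule ccontr)
    assume "\<not> 0 < a"
    then have "1/a \<le> 0" by (simp add: divide_nonneg_nonpos)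
    with a1 show False by linarith
  qed
  have a: "a \<ge> 1" using a1 a0 by (simp add: field_simps)
  define \<alpha> \<beta> where "\<alpha> = 3/2 - 1/a" and "\<beta> = 3/2 - 1/r"
  have \<alpha>\<beta>: "0 \<le> \<alpha>" "\<alpha> < 1" "0 \<le> \<beta>" "\<beta> < 1" using a1 r1 by (auto simp: \<alpha>_def \<beta>_def)
  define c where "c = (3 * pi * 2 powr a) powr (1/a) * B powr (1/r)"
  define b where "b = 2 powr \<alpha> / (1 - \<beta>) + 2 powr \<beta> / (1 - \<alpha>)"
  have cb: "c > 0" "b > 0" using B \<alpha>\<beta> by (auto simp: c_def b_def intro!: add_pos_pos)
  let ?m = "measure \<mu> UNIV"
  define h where "h = (3 * ?m) powr (q - 1) * (6 * pi * ?m)"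
  have h: "h \<ge> 0" by (simp add: h_def)
  have \<mu>: "M_plus \<mu>" using sol by (simp add: mild_solution_def)
  have main: "(\<integral>\<^sup>+x. ennreal (\<bar>u t x\<bar> powr q) \<partial>lborel) \<le> ennreal (2 powr q * (h + (2 * (c * b)) powr q) * t powr (1 - q))"
    if t: "t \<in> {0<..<T}" for t
  proof -
    let ?S = "restrict_space lborel {0<..<t}"
    have t0: "t > 0" using t by simp
    have [measurable]: "u t \<in> borel_measurable lborel" using sol t by (auto simp: mild_solution_def)
    have [measurable]: "heat_measure t \<mu> \<in> borel_measurable borel" by (rule heat_measure_measurable[OF \<mu>])
    define v where "v x = max 0 (\<bar>u t x\<bar> - heat_measure t \<mu> x)" for x
    have [measurable]: "v \<in> borel_measurable lborel" unfolding v_def by measurable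
    have "(\<integral>\<^sup>+x. ennreal (v x powr q) \<partial>lborel) \<le> ennreal ((2 * (c * b * t powr (1/q - 1))) powr q)"
    proof (rule Young_Minkowski[where S = ?S and a = a and r = r and q = q
            and G = "\<lambda>s z. norm (grad_heat_kernel (t - s) z)" and f = "flux u"
            and A = "\<lambda>s. 3 * pi * 2 powr a * (t - s) powr (1 - 3/2 * a)"
            and B = "\<lambda>s. B * s powr (1 - 3/2 * r)"])
      show "sigma_finite_measure ?S"
        by (intro sigma_finite_measure_restrict_space sigma_finite_lborel) auto
      show "(\<lambda>(s, y). flux u s y) \<in> borel_measurable (?S \<Otimes>\<^sub>M lborel)"
        by (rule mild_flux_measurable[OF sol t])
      show "(\<lambda>(s, z). norm (grad_heat_kernel (t - s) z)) \<in> borel_measurable (?S \<Otimes>\<^sub>M lborel)"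
        by (rule measurable_compose[OF measurable_restrict_space_pair_ident]) measurable
      show "(\<lambda>s. 3 * pi * 2 powr a * (t - s) powr (1 - 3/2 * a)) \<in> borel_measurable ?S"
        "(\<lambda>s. B * s powr (1 - 3/2 * r)) \<in> borel_measurable ?S"
        by (rule measurable_restrict_space1, measurable)+
      show "1 + 1/q = 1/a + 1/r" by (simp add: ia)
      show "(\<integral>\<^sup>+z. ennreal (norm (grad_heat_kernel (t - s) z) powr a) \<partial>lborel)
          \<le> ennreal (3 * pi * 2 powr a * (t - s) powr (1 - 3/2 * a))" if "s \<in> space ?S" for s
        using that a by (intro nn_integral_grad_heat_kernel_powr_le) auto
      show "(\<integral>\<^sup>+z. ennreal (flux u s z powr r) \<partial>lborel) \<le> ennreal (B * s powr (1 - 3/2 * r))" if "s \<in> space ?S" for s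
        using that t by (intro fB) auto
      show "AE x in lborel. ennreal (v x) \<le> (\<integral>\<^sup>+s. (\<integral>\<^sup>+y. ennreal (norm (grad_heat_kernel (t - s) (x - y)) * flux u s y) \<partial>lborel) \<partial>?S)"
        using mild_duhamel_bound[OF sol t]
        unfolding v_def by eventually_elim (rule ennreal_max_diff_le[OF _ heat_measure_nonneg[OF t0]])
      have "(\<integral>\<^sup>+s. ennreal ((3 * pi * 2 powr a * (t - s) powr (1 - 3/2 * a)) powr (1/a) * (B * s powr (1 - 3/2 * r)) powr (1/r)) \<partial>?S)
          = (\<integral>\<^sup>+s. ennreal c * ennreal ((t - s) powr (- \<alpha>) * s powr (- \<beta>)) \<partial>?S)"
      proof (rule nn_integral_cong)
        fix s
        have "(1 - 3/2 * a) * (1/a) = - \<alpha>" "(1 - 3/2 * r) * (1/r) = - \<beta>"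
          using a0 rq by (auto simp: \<alpha>_def \<beta>_def field_simps)
        then have "(3 * pi * 2 powr a * (t - s) powr (1 - 3/2 * a)) powr (1/a) * (B * s powr (1 - 3/2 * r)) powr (1/r)
            = c * ((t - s) powr (- \<alpha>) * s powr (- \<beta>))"
          using B by (subst (1 2) powr_mult) (auto simp: powr_powr c_def)
        then show "ennreal ((3 * pi * 2 powr a * (t - s) powr (1 - 3/2 * a)) powr (1/a) * (B * s powr (1 - 3/2 * r)) powr (1/r))
            = ennreal c * ennreal ((t - s) powr (- \<alpha>) * s powr (- \<beta>))"
          using cb by (simp add: ennreal_mult)
      qed
      also have "\<dots> = ennreal c * (\<integral>\<^sup>+s. ennreal ((t - s) powr (- \<alpha>) * s powr (- \<beta>)) \<partial>?S)"
        by (intro nn_integral_cmult measurable_restrict_space1) measurable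
      also have "\<dots> \<le> ennreal c * ennreal (b * t powr (1 - \<alpha> - \<beta>))"
        unfolding b_def using \<alpha>\<beta> t0 by (intro mult_left_mono nn_integral_beta_le) auto
      also have "1 - \<alpha> - \<beta> = 1/q - 1" by (simp add: \<alpha>_def \<beta>_def ia)
      also have "ennreal c * ennreal (b * t powr (1/q - 1)) = ennreal (c * b * t powr (1/q - 1))"
        using cb by (simp add: mult.assoc flip: ennreal_mult')
      finally show "(\<integral>\<^sup>+s. ennreal ((3 * pi * 2 powr a * (t - s) powr (1 - 3/2 * a)) powr (1/a) * (B * s powr (1 - 3/2 * r)) powr (1/r)) \<partial>?S)
          \<le> ennreal (c * b * t powr (1/q - 1))" .
    qed (use a rq cb B t0 in \<open>auto simp: flux_nonneg v_def\<close>)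
    also have "(2 * (c * b * t powr (1/q - 1))) powr q = (2 * (c * b)) powr q * t powr (1 - q)"
    proof -
      have "(1/q - 1) * q = 1 - q" using rq by (simp add: field_simps)
      then show ?thesis using cb by (simp add: powr_mult powr_powr mult.assoc)
    qed
    finally have v: "(\<integral>\<^sup>+x. ennreal (v x powr q) \<partial>lborel) \<le> ennreal ((2 * (c * b)) powr q * t powr (1 - q))" .
    have "(\<integral>\<^sup>+x. ennreal (\<bar>u t x\<bar> powr q) \<partial>lborel)
        \<le> (\<integral>\<^sup>+x. ennreal (2 powr q) * (ennreal (heat_measure t \<mu> x powr q) + ennreal (v x powr q)) \<partial>lborel)"
    proof (rule nn_integral_mono)
      fix x
      have "\<bar>u t x\<bar> powr q \<le> (heat_measure t \<mu> x + v x) powr q"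
        using rq by (intro powr_mono2) (auto simp: v_def)
      also have "\<dots> \<le> 2 powr q * (heat_measure t \<mu> x powr q + v x powr q)"
        using heat_measure_nonneg[OF t0] rq by (intro powr_add_le) (auto simp: v_def)
      finally show "ennreal (\<bar>u t x\<bar> powr q) \<le> ennreal (2 powr q) * (ennreal (heat_measure t \<mu> x powr q) + ennreal (v x powr q))"
        by (simp flip: ennreal_mult' ennreal_plus)
    qed
    also have "\<dots> = ennreal (2 powr q) * ((\<integral>\<^sup>+x. ennreal (heat_measure t \<mu> x powr q) \<partial>lborel) + (\<integral>\<^sup>+x. ennreal (v x powr q) \<partial>lborel))"
      by (simp add: nn_integral_cmult nn_integral_add)
    also have "\<dots> \<le> ennreal (2 powr q) * (ennreal (h * t powr (1 - q)) + ennreal ((2 * (c * b)) powr q * t powr (1 - q)))"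
      using nn_integral_heat_measure_powr_le[OF \<mu> t0, of q] rq
      by (intro mult_left_mono add_mono v) (auto simp: h_def)
    also have "\<dots> = ennreal (2 powr q * (h + (2 * (c * b)) powr q) * t powr (1 - q))"
      using h by (simp add: algebra_simps flip: ennreal_mult' ennreal_plus)
    finally show ?thesis .
  qed
  have "2 powr q * (h + (2 * (c * b)) powr q) > 0"
    using cb h by (intro mult_pos_pos add_nonneg_pos) auto
  with main show ?thesis by blast
qed

lemma mild_flux_L1:
  assumes sol: "mild_solution T \<mu> u"
  shows "\<exists>B>0. \<forall>s\<in>{0<..<T}. (\<integral>\<^sup>+y. ennreal (flux u s y) \<partial>lborel) \<le> ennreal (B * s powr (- 1/2))"
proof -
  obtain K where K: "\<And>t. t \<in> {0<..<T} \<Longrightarrow> in_Lp (4/3) (u t) \<and> t powr (1/4) * Lp_norm (4/3) (u t) \<le> K"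
    using sol unfolding mild_solution_def by blast
  define k where "k = max K 1"
  have k: "k > 0" by (simp add: k_def)
  have "(\<integral>\<^sup>+y. ennreal (flux u s y) \<partial>lborel) \<le> ennreal (6 * pi * k powr 2 * s powr (- 1/2))"
    if s: "s \<in> {0<..<T}" for s
  proof -
    have s0: "s > 0" using s by simp
    have [measurable]: "u s \<in> borel_measurable lborel" using sol s by (auto simp: mild_solution_def)
    have "s powr (1/4) * Lp_norm (4/3) (u s) \<le> k" using K[OF s] unfolding k_def by linarith
    then have "Lp_norm (4/3) (u s) \<le> k * s powr (- 1/4)"
      using s0 by (simp add: powr_minus_divide field_simps)
    then have "(\<integral>\<^sup>+x. ennreal (\<bar>u s x\<bar> powr (4/3)) \<partial>lborel) \<le> ennreal ((k * s powr (- 1/4)) powr (4/3))"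
      using K[OF s] k by (intro nn_integral_powr_le_of_Lp_norm) auto
    then have "(\<integral>\<^sup>+y. (\<integral>\<^sup>+z. ennreal (\<bar>u s y\<bar> * (\<bar>u s z\<bar> / norm (y - z))) \<partial>lborel) \<partial>lborel)
        \<le> ennreal (6 * pi * ((k * s powr (- 1/4)) powr (4/3)) powr (3/2))"
      using k s0 by (intro HLS_diagonal) auto
    also have "((k * s powr (- 1/4)) powr (4/3)) powr (3/2) = k powr 2 * s powr (- 1/2)"
      using k by (simp add: powr_powr powr_mult)
    finally have hls: "(\<integral>\<^sup>+y. (\<integral>\<^sup>+z. ennreal (\<bar>u s y\<bar> * (\<bar>u s z\<bar> / norm (y - z))) \<partial>lborel) \<partial>lborel)
        \<le> ennreal (6 * pi * k powr 2 * s powr (- 1/2))" by (simp add: mult.assoc)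
    have pw: "ennreal (flux u s y) \<le> (\<integral>\<^sup>+z. ennreal (\<bar>u s y\<bar> * (\<bar>u s z\<bar> / norm (y - z))) \<partial>lborel)" for y
    proof -
      have "ennreal (flux u s y) = ennreal \<bar>u s y\<bar> * ennreal (norm (grad_c (u s) y))"
        by (simp add: flux_def ennreal_mult)
      also have "\<dots> \<le> ennreal \<bar>u s y\<bar> * (\<integral>\<^sup>+z. ennreal (\<bar>u s z\<bar> / norm (y - z)) \<partial>lborel)"
        by (intro mult_left_mono norm_grad_c_le) auto
      also have "\<dots> = (\<integral>\<^sup>+z. ennreal \<bar>u s y\<bar> * ennreal (\<bar>u s z\<bar> / norm (y - z)) \<partial>lborel)"
        by (rule nn_integral_cmult[symmetric]) measurable
      finally show ?thesis by (simp flip: ennreal_mult')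
    qed
    show ?thesis by (rule order.trans[OF nn_integral_mono hls]) (rule pw)
  qed
  moreover have "6 * pi * k powr 2 > 0" using k by simp
  ultimately show ?thesis by blast
qed

lemma nn_integral_flux_powr_le:
  assumes [measurable]: "u s \<in> borel_measurable lborel" and s: "s > 0" and C: "C\<^sub>1 > 0" "C\<^sub>2 > 0"
    and v1: "(\<integral>\<^sup>+z. ennreal \<bar>u s z\<bar> \<partial>lborel) \<le> ennreal C\<^sub>1"
    and v2: "(\<integral>\<^sup>+z. ennreal (\<bar>u s z\<bar> powr (7/4)) \<partial>lborel) \<le> ennreal (C\<^sub>2 * s powr (- 3/4))"
  defines "C\<^sub>3 \<equiv> (2 * ((10/3 * pi) powr (5/7) * C\<^sub>2 powr (4/7))) powr (7/2)"
  shows "(\<integral>\<^sup>+y. ennreal (flux u s y powr (7/6)) \<partial>lborel)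
    \<le> ennreal (2 powr (7/6) * (2 powr (7/6) * (C\<^sub>2 + C\<^sub>3) + C\<^sub>1 powr (7/6) * (C\<^sub>1 + C\<^sub>2)) * s powr (- 3/4))"
proof -
  define w where "w y = max 0 (norm (grad_c (u s) y) - C\<^sub>1 / sqrt s)" for y
  note [measurable] = grad_c_measurable[OF assms(1)]
  have [measurable]: "w \<in> borel_measurable lborel" unfolding w_def by measurable
  have C3: "C\<^sub>3 \<ge> 0" by (simp add: C\<^sub>3_def)
  define k l where "k = (2::real) powr (7/6)" and "l = C\<^sub>1 powr (7/6)"
  have kl: "k \<ge> 0" "l \<ge> 0" by (auto simp: k_def l_def)
  define \<sigma> where "\<sigma> = s powr (- 3/4)"
  have \<sigma>: "\<sigma> \<ge> 0" by (simp add: \<sigma>_def)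
  have w2: "(\<integral>\<^sup>+y. ennreal (w y powr (7/2)) \<partial>lborel) \<le> ennreal (C\<^sub>3 * \<sigma>)"
    unfolding w_def C\<^sub>3_def \<sigma>_def by (rule nn_integral_grad_c_excess_powr_le) (use s C v1 v2 in auto)
  have "(\<integral>\<^sup>+y. ennreal (flux u s y powr (7/6)) \<partial>lborel)
      \<le> (\<integral>\<^sup>+y. ennreal k * (ennreal k * (ennreal (\<bar>u s y\<bar> powr (7/4)) + ennreal (w y powr (7/2)))
        + ennreal l * (ennreal \<sigma> * ennreal \<bar>u s y\<bar> + ennreal (\<bar>u s y\<bar> powr (7/4)))) \<partial>lborel)"
  proof (rule nn_integral_mono)
    fix y
    have "flux u s y powr (7/6) \<le> k * (k * (\<bar>u s y\<bar> powr (7/4) + w y powr (7/2)) + l * (\<sigma> * \<bar>u s y\<bar> + \<bar>u s y\<bar> powr (7/4)))"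
      using flux_powr_pointwise[of "\<bar>u s y\<bar>" "norm (grad_c (u s) y)" C\<^sub>1 s] C s
      by (simp add: flux_def w_def k_def l_def \<sigma>_def)
    also have "ennreal \<dots> = ennreal k * (ennreal k * (ennreal (\<bar>u s y\<bar> powr (7/4)) + ennreal (w y powr (7/2)))
        + ennreal l * (ennreal \<sigma> * ennreal \<bar>u s y\<bar> + ennreal (\<bar>u s y\<bar> powr (7/4))))"
      using kl \<sigma> by (simp add: ennreal_mult ennreal_plus)
    finally show "ennreal (flux u s y powr (7/6)) \<le> \<dots>" by (simp add: ennreal_leI)
  qed
  also have "\<dots> = ennreal k * (ennreal k * ((\<integral>\<^sup>+y. ennreal (\<bar>u s y\<bar> powr (7/4)) \<partial>lborel) + (\<integral>\<^sup>+y. ennreal (w y powr (7/2)) \<partial>lborel))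
        + ennreal l * (ennreal \<sigma> * (\<integral>\<^sup>+y. ennreal \<bar>u s y\<bar> \<partial>lborel) + (\<integral>\<^sup>+y. ennreal (\<bar>u s y\<bar> powr (7/4)) \<partial>lborel)))"
    by (simp add: nn_integral_add nn_integral_cmult)
  also have "\<dots> \<le> ennreal k * (ennreal k * (ennreal (C\<^sub>2 * \<sigma>) + ennreal (C\<^sub>3 * \<sigma>))
        + ennreal l * (ennreal \<sigma> * ennreal C\<^sub>1 + ennreal (C\<^sub>2 * \<sigma>)))"
    using v1 v2 w2 by (intro mult_left_mono add_mono) (auto simp: \<sigma>_def)
  also have "\<dots> = ennreal (k * (k * (C\<^sub>2 * \<sigma> + C\<^sub>3 * \<sigma>) + l * (\<sigma> * C\<^sub>1 + C\<^sub>2 * \<sigma>)))"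
    using kl \<sigma> C C3 by (simp add: ennreal_mult ennreal_plus)
  also have "k * (k * (C\<^sub>2 * \<sigma> + C\<^sub>3 * \<sigma>) + l * (\<sigma> * C\<^sub>1 + C\<^sub>2 * \<sigma>)) = k * (k * (C\<^sub>2 + C\<^sub>3) + l * (C\<^sub>1 + C\<^sub>2)) * \<sigma>"
    by (simp add: algebra_simps)
  finally show ?thesis by (simp add: k_def l_def \<sigma>_def)
qed

lemma mild_powr_bounds:
  assumes sol: "mild_solution T \<mu> u"
  shows "\<exists>C\<^sub>1>0. \<exists>C\<^sub>2>0. \<forall>t\<in>{0<..<T}. (\<integral>\<^sup>+x. ennreal \<bar>u t x\<bar> \<partial>lborel) \<le> ennreal C\<^sub>1 \<and>
    (\<integral>\<^sup>+x. ennreal (\<bar>u t x\<bar> powr (5/2)) \<partial>lborel) \<le> ennreal (C\<^sub>2 * t powr (- 3/2))"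
proof -
  have um: "u t \<in> borel_measurable lborel" if "t \<in> {0<..<T}" for t
    using sol that by (auto simp: mild_solution_def)
  obtain B where B: "B > 0" "\<And>s. s \<in> {0<..<T} \<Longrightarrow> (\<integral>\<^sup>+y. ennreal (flux u s y) \<partial>lborel) \<le> ennreal (B * s powr (- 1/2))"
    using mild_flux_L1[OF sol] by blast
  have B1: "(\<integral>\<^sup>+y. ennreal (flux u s y powr 1) \<partial>lborel) \<le> ennreal (B * s powr (1 - 3/2 * 1))" if "s \<in> {0<..<T}" for s
    using B(2)[OF that] by (simp add: flux_nonneg)
  obtain C\<^sub>1 where C1: "C\<^sub>1 > 0" "\<And>t. t \<in> {0<..<T} \<Longrightarrow> (\<integral>\<^sup>+x. ennreal \<bar>u t x\<bar> \<partial>lborel) \<le> ennreal C\<^sub>1"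
  proof -
    obtain C where "C > 0" "\<And>t. t \<in> {0<..<T} \<Longrightarrow> (\<integral>\<^sup>+x. ennreal (\<bar>u t x\<bar> powr 1) \<partial>lborel) \<le> ennreal (C * t powr (1 - 1))"
      using mild_smoothing[OF sol _ _ _ _ _ B(1) B1, of 1] by auto
    then show ?thesis using that[of C] by simp
  qed
  obtain C\<^sub>2 where C2: "C\<^sub>2 > 0" "\<And>t. t \<in> {0<..<T} \<Longrightarrow> (\<integral>\<^sup>+x. ennreal (\<bar>u t x\<bar> powr (7/4)) \<partial>lborel) \<le> ennreal (C\<^sub>2 * t powr (- 3/4))"
    using mild_smoothing[OF sol _ _ _ _ _ B(1) B1, of "7/4"] by auto
  define C\<^sub>3 where "C\<^sub>3 = (2 * ((10/3 * pi) powr (5/7) * C\<^sub>2 powr (4/7))) powr (7/2)"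
  define D where "D = 2 powr (7/6) * (2 powr (7/6) * (C\<^sub>2 + C\<^sub>3) + C\<^sub>1 powr (7/6) * (C\<^sub>1 + C\<^sub>2))"
  have "C\<^sub>3 \<ge> 0" by (simp add: C\<^sub>3_def)
  then have D: "D > 0" using C1(1) C2(1) unfolding D_def by (intro mult_pos_pos add_pos_pos add_pos_nonneg) auto
  have "(\<integral>\<^sup>+y. ennreal (flux u s y powr (7/6)) \<partial>lborel) \<le> ennreal (D * s powr (1 - 3/2 * (7/6)))"
    if s: "s \<in> {0<..<T}" for s
    using nn_integral_flux_powr_le[where u = u and s = s, OF um[OF s] _ C1(1) C2(1) C1(2)[OF s] C2(2)[OF s]] s
    by (simp add: D_def C\<^sub>3_def)
  from mild_smoothing[OF sol _ _ _ _ _ D this, of "5/2"]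
  obtain E where "E > 0" "\<And>t. t \<in> {0<..<T} \<Longrightarrow> (\<integral>\<^sup>+x. ennreal (\<bar>u t x\<bar> powr (5/2)) \<partial>lborel) \<le> ennreal (E * t powr (- 3/2))"
    by auto
  with C1 show ?thesis by blast
qed

lemma mild_Linf_bound:
  assumes sol: "mild_solution T \<mu> u"
  shows "\<exists>L>0. \<forall>t\<in>{0<..<T}. AE x in lborel. \<bar>u t x\<bar> \<le> L / t"
proof -
  have \<mu>: "M_plus \<mu>" using sol by (simp add: mild_solution_def)
  obtain C\<^sub>1 C\<^sub>2 where C: "C\<^sub>1 > 0" "C\<^sub>2 > 0"
    and u1: "\<And>t. t \<in> {0<..<T} \<Longrightarrow> (\<integral>\<^sup>+x. ennreal \<bar>u t x\<bar> \<partial>lborel) \<le> ennreal C\<^sub>1"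
    and u2: "\<And>t. t \<in> {0<..<T} \<Longrightarrow> (\<integral>\<^sup>+x. ennreal (\<bar>u t x\<bar> powr (5/2)) \<partial>lborel) \<le> ennreal (C\<^sub>2 * t powr (- 3/2))"
    using mild_powr_bounds[OF sol] by auto
  obtain B where B: "B > 0" "\<And>s. s \<in> {0<..<T} \<Longrightarrow> (\<integral>\<^sup>+y. ennreal (flux u s y) \<partial>lborel) \<le> ennreal (B * s powr (- 1/2))"
    using mild_flux_L1[OF sol] by blast
  define E where "E = C\<^sub>1 + (6 * pi) powr (3/5) * C\<^sub>2 powr (2/5)"
  have E: "E > 0" using C by (simp add: E_def add_pos_nonneg)
  define k l where "k = 2 * 2 powr (3/2) * B"
    and "l = E * ((3 * pi * 2 powr (5/3)) powr (3/5) * C\<^sub>2 powr (2/5)) * 2 powr (11/10)"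
  have kl: "k > 0" "l > 0" using B C E by (auto simp: k_def l_def)
  define b c where "b = 2 powr 0 / (1 - 1/2) + 2 powr (1/2) / (1 - 0::real)"
    and "c = 2 powr (9/10) / (1 - 0) + 2 powr 0 / (1 - 9/10::real)"
  have bc: "b > 0" "c > 0" by (auto simp: b_def c_def intro!: add_pos_pos)
  define L where "L = 3 * measure \<mu> UNIV + (k * b + l * c)"
  have "k * b + l * c > 0" using kl bc by (intro add_pos_pos mult_pos_pos)
  then have L: "L > 0" using measure_nonneg[of \<mu> UNIV] unfolding L_def by linarith
  have "AE x in lborel. \<bar>u t x\<bar> \<le> L / t" if t: "t \<in> {0<..<T}" for t
  proof -
    let ?S = "restrict_space lborel {0<..<t}"
    have t0: "t > 0" using t by simp
    let ?p = "\<lambda>s. k * t powr (- 3/2) * s powr (- 1/2)"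
    let ?q = "\<lambda>s. l * t powr (- 11/10) * (t - s) powr (- 9/10)"
    have inner: "(\<integral>\<^sup>+y. ennreal (norm (grad_heat_kernel (t - s) (x - y)) * flux u s y) \<partial>lborel)
        \<le> ennreal (?p s + ?q s)" if s: "s \<in> {0<..<t}" for s x
    proof -
      have sT: "s \<in> {0<..<T}" and s0: "0 < s" "s < t" using s t by auto
      have [measurable]: "u s \<in> borel_measurable lborel" using sol sT by (auto simp: mild_solution_def)
      note [measurable] = grad_c_measurable[OF this]
      have [measurable]: "flux u s \<in> borel_measurable lborel" unfolding flux_def by measurable
      show ?thesis
      proof (cases "s \<le> t / 2")
        case True
        have g: "norm (grad_heat_kernel (t - s) z) \<le> 2 * (t / 2) powr (- 3/2)" for z
        proof -
          have "norm (grad_heat_kernel (t - s) z) \<le> 2 * (t - s) powr (- 3/2)"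
            using s0 by (intro norm_grad_heat_kernel_le) auto
          also have "\<dots> \<le> 2 * (t / 2) powr (- 3/2)"
            using True s0 by (intro mult_left_mono powr_mono2') auto
          finally show ?thesis .
        qed
        have "(\<integral>\<^sup>+y. ennreal (norm (grad_heat_kernel (t - s) (x - y)) * flux u s y) \<partial>lborel)
            \<le> (\<integral>\<^sup>+y. ennreal (2 * (t / 2) powr (- 3/2)) * ennreal (flux u s y) \<partial>lborel)"
          using g by (intro nn_integral_mono) (auto simp: flux_nonneg simp flip: ennreal_mult' intro!: ennreal_leI mult_right_mono)
        also have "\<dots> = ennreal (2 * (t / 2) powr (- 3/2)) * (\<integral>\<^sup>+y. ennreal (flux u s y) \<partial>lborel)"
          by (rule nn_integral_cmult) measurable
        also have "\<dots> \<le> ennreal (2 * (t / 2) powr (- 3/2)) * ennreal (B * s powr (- 1/2))"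
          by (intro mult_left_mono B(2) sT) auto
        also have "\<dots> = ennreal (?p s)"
        proof -
          have "(t / 2) powr (- 3/2) = 2 powr (3/2) * t powr (- 3/2)"
            using t0 by (simp add: powr_divide powr_minus_divide)
          then show ?thesis using B by (simp add: k_def mult_ac flip: ennreal_mult')
        qed
        also have "\<dots> \<le> ennreal (?p s + ?q s)" using kl by (intro ennreal_leI) auto
        finally show ?thesis .
      next
        case False
        have "(\<integral>\<^sup>+y. ennreal (norm (grad_heat_kernel (t - s) (x - y)) * flux u s y) \<partial>lborel)
            \<le> (\<integral>\<^sup>+y. ennreal (E * s powr (- 1/2)) * ennreal (norm (grad_heat_kernel (t - s) (x - y)) * \<bar>u s y\<bar>) \<partial>lborel)"
        proof (rule nn_integral_mono)
          fix y
          have "norm (grad_c (u s) y) \<le> E * s powr (- 1/2)"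
            unfolding E_def by (rule norm_grad_c_Linf_le) (use s0 C u1[OF sT] u2[OF sT] in auto)
          then have "norm (grad_heat_kernel (t - s) (x - y)) * flux u s y
              \<le> norm (grad_heat_kernel (t - s) (x - y)) * (\<bar>u s y\<bar> * (E * s powr (- 1/2)))"
            by (auto simp: flux_def intro!: mult_left_mono)
          then show "ennreal (norm (grad_heat_kernel (t - s) (x - y)) * flux u s y)
              \<le> ennreal (E * s powr (- 1/2)) * ennreal (norm (grad_heat_kernel (t - s) (x - y)) * \<bar>u s y\<bar>)"
            using E by (simp add: mult_ac ennreal_leI flip: ennreal_mult')
        qed
        also have "\<dots> = ennreal (E * s powr (- 1/2)) * (\<integral>\<^sup>+y. ennreal (norm (grad_heat_kernel (t - s) (x - y)) * \<bar>u s y\<bar>) \<partial>lborel)"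
          by (rule nn_integral_cmult) measurable
        also have "\<dots> \<le> ennreal (E * s powr (- 1/2)) *
            ennreal ((3 * pi * 2 powr (5/3) * (t - s) powr (1 - 3/2 * (5/3))) powr (1/(5/3)) * (C\<^sub>2 * s powr (- 3/2)) powr (1/(5/2)))"
        proof (intro mult_left_mono nn_integral_Holder)
          have "(\<integral>\<^sup>+y. ennreal (norm (grad_heat_kernel (t - s) (x - y)) powr (5/3)) \<partial>lborel)
              = (\<integral>\<^sup>+y. ennreal (norm (grad_heat_kernel (t - s) y) powr (5/3)) \<partial>lborel)"
            by (rule nn_integral_lborel_diff) measurable
          also have "\<dots> \<le> ennreal (3 * pi * 2 powr (5/3) * (t - s) powr (1 - 3/2 * (5/3)))"
            using s0 by (intro nn_integral_grad_heat_kernel_powr_le) auto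
          finally show "(\<integral>\<^sup>+y. ennreal (norm (grad_heat_kernel (t - s) (x - y)) powr (5/3)) \<partial>lborel) \<le> \<dots>" .
        qed (use C u2[OF sT] in auto)
        also have "(3 * pi * 2 powr (5/3) * (t - s) powr (1 - 3/2 * (5/3))) powr (1/(5/3)) * (C\<^sub>2 * s powr (- 3/2)) powr (1/(5/2))
            = ((3 * pi * 2 powr (5/3)) powr (3/5) * C\<^sub>2 powr (2/5)) * ((t - s) powr (- 9/10) * s powr (- 3/5))"
          using C by (subst (1 2) powr_mult) (auto simp: powr_powr)
        also have "ennreal (E * s powr (- 1/2)) * ennreal \<dots>
            = ennreal (E * ((3 * pi * 2 powr (5/3)) powr (3/5) * C\<^sub>2 powr (2/5)) * (t - s) powr (- 9/10) * (s powr (- 1/2) * s powr (- 3/5)))"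
          using E by (simp add: mult_ac flip: ennreal_mult')
        also have "s powr (- 1/2) * s powr (- 3/5) = s powr (- 11/10)"
          by (simp only: powr_add[symmetric]) simp
        also have "ennreal (E * ((3 * pi * 2 powr (5/3)) powr (3/5) * C\<^sub>2 powr (2/5)) * (t - s) powr (- 9/10) * s powr (- 11/10)) \<le> ennreal (?q s)"
        proof (rule ennreal_leI)
          have "s powr (- 11/10) \<le> (t / 2) powr (- 11/10)"
            using False t0 by (intro powr_mono2') auto
          also have "\<dots> = 2 powr (11/10) * t powr (- 11/10)"
            using t0 by (simp add: powr_divide powr_minus_divide)
          finally have "E * ((3 * pi * 2 powr (5/3)) powr (3/5) * C\<^sub>2 powr (2/5)) * (t - s) powr (- 9/10) * s powr (- 11/10)
              \<le> E * ((3 * pi * 2 powr (5/3)) powr (3/5) * C\<^sub>2 powr (2/5)) * (t - s) powr (- 9/10) * (2 powr (11/10) * t powr (- 11/10))"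
            using E by (intro mult_left_mono) auto
          then show "E * ((3 * pi * 2 powr (5/3)) powr (3/5) * C\<^sub>2 powr (2/5)) * (t - s) powr (- 9/10) * s powr (- 11/10) \<le> ?q s"
            by (simp add: l_def mult_ac)
        qed
        also have "\<dots> \<le> ennreal (?p s + ?q s)" using kl by (intro ennreal_leI) auto
        finally show ?thesis .
      qed
    qed
    have total: "(\<integral>\<^sup>+s. (\<integral>\<^sup>+y. ennreal (norm (grad_heat_kernel (t - s) (x - y)) * flux u s y) \<partial>lborel) \<partial>?S) \<le> ennreal ((k * b + l * c) / t)" for x
    proof -
      have m: "(\<lambda>s. ennreal ((t - s) powr (- \<alpha>) * s powr (- \<beta>))) \<in> borel_measurable ?S" for \<alpha> \<beta>
        by (rule measurable_restrict_space1) measurable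
      have "(\<integral>\<^sup>+s. (\<integral>\<^sup>+y. ennreal (norm (grad_heat_kernel (t - s) (x - y)) * flux u s y) \<partial>lborel) \<partial>?S)
          \<le> (\<integral>\<^sup>+s. ennreal (k * t powr (- 3/2)) * ennreal ((t - s) powr (- 0) * s powr (- (1/2)))
            + ennreal (l * t powr (- 11/10)) * ennreal ((t - s) powr (- (9/10)) * s powr (- 0)) \<partial>?S)"
      proof (rule nn_integral_mono)
        fix s assume "s \<in> space ?S"
        then have s: "s \<in> {0<..<t}" by simp
        have "?p s + ?q s = k * t powr (- 3/2) * ((t - s) powr (- 0) * s powr (- (1/2)))
            + l * t powr (- 11/10) * ((t - s) powr (- (9/10)) * s powr (- 0))" using s by simp
        moreover have "ennreal (k * t powr (- 3/2) * P + l * t powr (- 11/10) * Q)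
            = ennreal (k * t powr (- 3/2)) * ennreal P + ennreal (l * t powr (- 11/10)) * ennreal Q"
          if "0 \<le> P" "0 \<le> Q" for P Q
          using that kl by (simp flip: ennreal_mult' ennreal_plus)
        ultimately have "ennreal (?p s + ?q s) = ennreal (k * t powr (- 3/2)) * ennreal ((t - s) powr (- 0) * s powr (- (1/2)))
            + ennreal (l * t powr (- 11/10)) * ennreal ((t - s) powr (- (9/10)) * s powr (- 0))"
          by (metis mult_nonneg_nonneg powr_ge_zero)
        then show "(\<integral>\<^sup>+y. ennreal (norm (grad_heat_kernel (t - s) (x - y)) * flux u s y) \<partial>lborel)
            \<le> ennreal (k * t powr (- 3/2)) * ennreal ((t - s) powr (- 0) * s powr (- (1/2)))
            + ennreal (l * t powr (- 11/10)) * ennreal ((t - s) powr (- (9/10)) * s powr (- 0))"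
          using inner[OF s, of x] by (simp only:)
      qed
      also have "\<dots> = ennreal (k * t powr (- 3/2)) * (\<integral>\<^sup>+s. ennreal ((t - s) powr (- 0) * s powr (- (1/2))) \<partial>?S)
            + ennreal (l * t powr (- 11/10)) * (\<integral>\<^sup>+s. ennreal ((t - s) powr (- (9/10)) * s powr (- 0)) \<partial>?S)"
        using m[of 0 "1/2"] m[of "9/10" 0] by (simp only: nn_integral_add nn_integral_cmult borel_measurable_times_ennreal borel_measurable_const)
      also have "\<dots> \<le> ennreal (k * t powr (- 3/2)) * ennreal (b * t powr (1 - 0 - 1/2))
            + ennreal (l * t powr (- 11/10)) * ennreal (c * t powr (1 - 9/10 - 0))"
        unfolding b_def c_def using t0 by (intro add_mono mult_left_mono nn_integral_beta_le) auto
      also have "\<dots> = ennreal (k * b * (t powr (- 3/2) * t powr (1 - 0 - 1/2)) + l * c * (t powr (- 11/10) * t powr (1 - 9/10 - 0)))"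
        using kl bc by (simp add: mult_ac flip: ennreal_mult' ennreal_plus)
      also have "t powr (- 3/2) * t powr (1 - 0 - 1/2) = t powr (- 1)"
        by (simp only: powr_add[symmetric]) simp
      also have "t powr (- 11/10) * t powr (1 - 9/10 - 0) = t powr (- 1)"
        by (simp only: powr_add[symmetric]) simp
      also have "k * b * t powr (- 1) + l * c * t powr (- 1) = (k * b + l * c) / t"
        using t0 by (simp add: powr_minus_divide add_divide_distrib)
      finally show ?thesis .
    qed
    show ?thesis using mild_duhamel_bound[OF sol t]
    proof eventually_elim
      case (elim x)
      have "ennreal \<bar>u t x\<bar> \<le> ennreal (3 * measure \<mu> UNIV / t) + ennreal ((k * b + l * c) / t)"
        using elim by (rule order.trans) (intro add_mono total ennreal_leI heat_measure_le[OF \<mu> t0])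
      also have "\<dots> = ennreal (L / t)"
        using kl bc t0 by (simp add: L_def add_divide_distrib flip: ennreal_plus)
      finally show ?case using L t0 by (subst (asm) ennreal_le_iff) auto
    qed
  qed
  with L show ?thesis by blast
qed

theorem theorem1p2:
  fixes T :: real and \<mu> :: "R2 measure" and u :: "real \<Rightarrow> R2 \<Rightarrow> real"
  assumes "mild_solution T \<mu> u"
  shows "(\<forall>p::real. 1 \<le> p \<longrightarrow>
            (\<exists>C. \<forall>t\<in>{0<..<T}. in_Lp p (u t) \<and> t powr (1 - 1/p) * Lp_norm p (u t) \<le> C))
       \<and> (\<exists>C. \<forall>t\<in>{0<..<T}. in_Linf (u t) \<and> t * Linf_norm (u t) \<le> C)"
proof (intro conjI allI impI)
  have um: "u t \<in> borel_measurable lborel" if "t \<in> {0<..<T}" for t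
    using assms that by (auto simp: mild_solution_def)
  obtain L where L: "L > 0" "\<And>t. t \<in> {0<..<T} \<Longrightarrow> AE x in lborel. \<bar>u t x\<bar> \<le> L / t"
    using mild_Linf_bound[OF assms] by blast
  obtain M where M: "M > 0" "\<And>t. t \<in> {0<..<T} \<Longrightarrow> (\<integral>\<^sup>+x. ennreal \<bar>u t x\<bar> \<partial>lborel) \<le> ennreal M"
    using mild_powr_bounds[OF assms] by auto
  show "\<exists>C. \<forall>t\<in>{0<..<T}. in_Linf (u t) \<and> t * Linf_norm (u t) \<le> C"
  proof (intro exI ballI)
    fix t assume t: "t \<in> {0<..<T}"
    note [measurable] = um[OF t]
    have e: "esssup lborel (\<lambda>x. ereal \<bar>u t x\<bar>) \<le> ereal (L / t)"
      using L(2)[OF t] by (intro esssup_I) auto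
    then have "Linf_norm (u t) \<le> L / t"
      unfolding Linf_norm_def using L(1) t
      by (cases "esssup lborel (\<lambda>x. ereal \<bar>u t x\<bar>)") auto
    then show "in_Linf (u t) \<and> t * Linf_norm (u t) \<le> L"
      using e t by (auto simp: in_Linf_def field_simps intro: le_less_trans)
  qed
  fix p :: real assume p: "1 \<le> p"
  show "\<exists>C. \<forall>t\<in>{0<..<T}. in_Lp p (u t) \<and> t powr (1 - 1/p) * Lp_norm p (u t) \<le> C"
  proof (intro exI ballI)
    fix t assume t: "t \<in> {0<..<T}"
    note [measurable] = um[OF t]
    have t0: "t > 0" using t by simp
    have "(\<integral>\<^sup>+x. ennreal (\<bar>u t x\<bar> powr p) \<partial>lborel) \<le> (\<integral>\<^sup>+x. ennreal ((L / t) powr (p - 1)) * ennreal \<bar>u t x\<bar> \<partial>lborel)"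
    proof (rule nn_integral_mono_AE)
      show "AE x in lborel. ennreal (\<bar>u t x\<bar> powr p) \<le> ennreal ((L / t) powr (p - 1)) * ennreal \<bar>u t x\<bar>"
        using L(2)[OF t]
      proof eventually_elim
        case (elim x)
        have "\<bar>u t x\<bar> powr p = \<bar>u t x\<bar> powr (p - 1) * \<bar>u t x\<bar> powr 1"
          by (simp only: powr_add[symmetric]) simp
        also have "\<dots> \<le> (L / t) powr (p - 1) * \<bar>u t x\<bar>"
          using elim p by (simp add: mult_right_mono powr_mono2)
        finally show ?case by (simp add: ennreal_leI flip: ennreal_mult')
      qed
    qed
    also have "\<dots> = ennreal ((L / t) powr (p - 1)) * (\<integral>\<^sup>+x. ennreal \<bar>u t x\<bar> \<partial>lborel)"
      by (rule nn_integral_cmult) measurable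
    also have "\<dots> \<le> ennreal ((L / t) powr (p - 1)) * ennreal M"
      by (intro mult_left_mono M(2) t) auto
    also have "\<dots> = ennreal ((L / t) powr (p - 1) * M)" by (simp flip: ennreal_mult')
    finally have "in_Lp p (u t) \<and> Lp_norm p (u t) \<le> ((L / t) powr (p - 1) * M) powr (1/p)"
      using p M(1) by (intro Lp_norm_le_of_nn_integral_powr) auto
    moreover have "((L / t) powr (p - 1) * M) powr (1/p) = (L / t) powr (1 - 1/p) * M powr (1/p)"
    proof -
      have "(p - 1) * (1/p) = 1 - 1/p" using p by (simp add: field_simps)
      then show ?thesis using M(1) by (simp only: powr_mult powr_powr)
    qed
    moreover have "t powr (1 - 1/p) * ((L / t) powr (1 - 1/p) * M powr (1/p)) = L powr (1 - 1/p) * M powr (1/p)"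
    proof -
      have "t powr (1 - 1/p) * (L / t) powr (1 - 1/p) = L powr (1 - 1/p)"
        using t0 L(1) by (simp flip: powr_mult)
      then show ?thesis by (simp add: mult.assoc[symmetric])
    qed
    ultimately show "in_Lp p (u t) \<and> t powr (1 - 1/p) * Lp_norm p (u t) \<le> L powr (1 - 1/p) * M powr (1/p)"
      by (metis mult_left_mono powr_ge_zero)
  qed
qed

end
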